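(* If every round is single-crossing with respect to the same given voter order, then rank-wPSC can be satisfied by a polynomial-time online rule, also with the Droop size condition.
   Context: Model. Voters $V=[n]$, a set $C$ of $m$ candidates, rounds $T=\{1,\dots,|T|\}$ with $n,m,|T|\ge1$; $|T|$ is the horizon. In each round $j$ each voter $i$ has a strict complete ranking of $C$. The rankings in a round are single-crossing with respect to a linear order of $V$ if, for every pair of candidates $a,b$, the voters who prefer $a$ to $b$ form a prefix or a suffix of that order. For $r\in[m]$, $A_i^j(r)$ is the set of voter $i$'s $r$ most-preferred candidates in round $j$. A sequence is $W=(w^1,\dots,w^{|T|})\in C^{|T|}$. A group is a nonempty $S\subseteq V$. A rule maps each input to a sequence; it is online if each $w^j$ depends only on the rankings in rounds $1,\dots,j$ (and the given voter order) and not on $|T|$. A rule satisfies an axiom on a domain if its output does for every input from that domain. Rank-wPSC. For every rank vector $\mathbf r=(r^1,\dots,r^{|T|})\in[m]^{|T|}$, every positive integer $\ell$, and every group $S$ with $|S|\ge\ell n/|T|$ that is solid in every round, i.e. $|\bigcap_{i\in S}A_i^j(r^j)|=r^j$ for all $j\in T$, there are at least $\ell$ rounds $j$ with $w^j\in\bigcup_{i\in S}A_i^j(r^j)$. With the Droop size condition, the hypothesis $|S|\ge\ell n/|T|$ is replaced by $|S|>\ell n/(|T|+1)$. *)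

theory Defs
  imports Complex_Main "HOL-Computational_Algebra.Polynomial"
    "HOL-Combinatorics.Multiset_Permutations"
begin

section \<open>Elections over several rounds\<close>

text \<open>
  Voters, candidates and rounds are numbered from 0: the voters are \<open>{..<n}\<close>, the candidates
  \<open>{..<m}\<close> and the rounds \<open>{..<T}\<close>. \<open>rankings E ! j ! i\<close> is the ranking of voter \<open>i\<close> in round \<open>j\<close>,
  listed from most to least preferred; the horizon is the number of rounds listed.
\<close>

record election =
  num_voters :: nat
  num_cands :: nat
  voter_order :: "nat list"
  rankings :: "nat list list list"

definition horizon :: "election \<Rightarrow> nat" where
  "horizon E = length (rankings E)"

definition valid_election :: "election \<Rightarrow> bool" where
  "valid_election E \<longleftrightarrow>
     num_voters E \<ge> 1 \<and> num_cands E \<ge> 1 \<and> horizon E \<ge> 1 \<and>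
     voter_order E \<in> permutations_of_set {..<num_voters E} \<and>
     (\<forall>P \<in> set (rankings E). length P = num_voters E \<and>
        (\<forall>\<rho> \<in> set P. \<rho> \<in> permutations_of_set {..<num_cands E}))"

definition prefers :: "nat list \<Rightarrow> nat \<Rightarrow> nat \<Rightarrow> bool" where
  "prefers \<rho> a b \<longleftrightarrow> (\<exists>k l. k < l \<and> l < length \<rho> \<and> \<rho> ! k = a \<and> \<rho> ! l = b)"

definition single_crossing_round :: "election \<Rightarrow> nat \<Rightarrow> bool" where
  "single_crossing_round E j \<longleftrightarrow>
     (\<forall>a < num_cands E. \<forall>b < num_cands E.
        let X = {i. i < num_voters E \<and> prefers (rankings E ! j ! i) a b}
        in \<exists>k. X = set (take k (voter_order E)) \<or> X = set (drop k (voter_order E)))"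

definition single_crossing :: "election \<Rightarrow> bool" where
  "single_crossing E \<longleftrightarrow> (\<forall>j < horizon E. single_crossing_round E j)"

definition top_set :: "election \<Rightarrow> nat \<Rightarrow> nat \<Rightarrow> nat \<Rightarrow> nat set" where
  "top_set E i j r = set (take r (rankings E ! j ! i))"


section \<open>Rank-wPSC\<close>

text \<open>Only the values of a rank vector \<open>r\<close> at the rounds \<open>j < horizon E\<close> matter.\<close>

definition rank_vector :: "election \<Rightarrow> (nat \<Rightarrow> nat) \<Rightarrow> bool" where
  "rank_vector E r \<longleftrightarrow> (\<forall>j < horizon E. r j \<in> {1..num_cands E})"

definition group :: "election \<Rightarrow> nat set \<Rightarrow> bool" where
  "group E S \<longleftrightarrow> S \<noteq> {} \<and> S \<subseteq> {..<num_voters E}"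

definition solid :: "election \<Rightarrow> (nat \<Rightarrow> nat) \<Rightarrow> nat set \<Rightarrow> bool" where
  "solid E r S \<longleftrightarrow> (\<forall>j < horizon E. card (\<Inter>i\<in>S. top_set E i j (r j)) = r j)"

definition hare_size :: "election \<Rightarrow> nat \<Rightarrow> nat set \<Rightarrow> bool" where
  "hare_size E l S \<longleftrightarrow> real (card S) \<ge> real l * real (num_voters E) / real (horizon E)"

definition droop_size :: "election \<Rightarrow> nat \<Rightarrow> nat set \<Rightarrow> bool" where
  "droop_size E l S \<longleftrightarrow> real (card S) > real l * real (num_voters E) / (real (horizon E) + 1)"

definition rank_wPSC_wrt ::
  "(election \<Rightarrow> nat \<Rightarrow> nat set \<Rightarrow> bool) \<Rightarrow> election \<Rightarrow> nat list \<Rightarrow> bool" where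
  "rank_wPSC_wrt large E W \<longleftrightarrow>
     (\<forall>r l S. rank_vector E r \<longrightarrow> l \<ge> 1 \<longrightarrow> group E S \<longrightarrow> large E l S \<longrightarrow> solid E r S \<longrightarrow>
        card {j. j < horizon E \<and> W ! j \<in> (\<Union>i\<in>S. top_set E i j (r j))} \<ge> l)"

definition rank_wPSC :: "election \<Rightarrow> nat list \<Rightarrow> bool" where
  "rank_wPSC = rank_wPSC_wrt hare_size"

definition rank_wPSC_droop :: "election \<Rightarrow> nat list \<Rightarrow> bool" where
  "rank_wPSC_droop = rank_wPSC_wrt droop_size"


section \<open>Rules\<close>

definition rule :: "(election \<Rightarrow> nat list) \<Rightarrow> bool" where
  "rule f \<longleftrightarrow> (\<forall>E. valid_election E \<longrightarrow>
     length (f E) = horizon E \<and> set (f E) \<subseteq> {..<num_cands E})"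

definition online :: "(election \<Rightarrow> nat list) \<Rightarrow> bool" where
  "online f \<longleftrightarrow> (\<forall>E E' j. valid_election E \<longrightarrow> valid_election E' \<longrightarrow>
     num_voters E = num_voters E' \<longrightarrow> num_cands E = num_cands E' \<longrightarrow>
     voter_order E = voter_order E' \<longrightarrow>
     j < horizon E \<longrightarrow> j < horizon E' \<longrightarrow>
     take (Suc j) (rankings E) = take (Suc j) (rankings E') \<longrightarrow>
     f E ! j = f E' ! j)"

definition satisfies_on ::
  "(election \<Rightarrow> bool) \<Rightarrow> (election \<Rightarrow> nat list \<Rightarrow> bool) \<Rightarrow> (election \<Rightarrow> nat list) \<Rightarrow> bool" where
  "satisfies_on D axm f \<longleftrightarrow> (\<forall>E. valid_election E \<longrightarrow> D E \<longrightarrow> axm E (f E))"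


section \<open>Polynomial time\<close>

text \<open>
  The machine model is a random access machine, programmed with while loops, whose memory
  consists of arrays of natural numbers: \<open>s a i\<close> is the content of cell \<open>i\<close> of array \<open>a\<close>. A
  program mentions only finitely many arrays; a scalar variable is a cell with a constant index.
  The arithmetic operations are addition and truncated subtraction, and every assignment and
  every test takes one unit of time. Without multiplication, the bit length of the largest
  number in memory grows per step by at most a constant depending on the program, so this unit
  cost measure is polynomially equivalent to the running time of a Turing machine.
\<close>

type_synonym store = "nat \<Rightarrow> nat \<Rightarrow> nat"

datatype expr =
    Const nat
  | Read nat expr
  | Plus expr expr
  | Monus expr expr

datatype com =
    Write nat expr expr
  | Seq com com
  | If expr com com
  | While expr com

fun val :: "expr \<Rightarrow> store \<Rightarrow> nat" where
  "val (Const k) s = k"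
| "val (Read a e) s = s a (val e s)"
| "val (Plus e e') s = val e s + val e' s"
| "val (Monus e e') s = val e s - val e' s"

text \<open>
  \<open>exec c s t s'\<close>: started in store \<open>s\<close>, program \<open>c\<close> halts after \<open>t\<close> steps in store \<open>s'\<close>. Tests
  succeed on nonzero values.
\<close>

inductive exec :: "com \<Rightarrow> store \<Rightarrow> nat \<Rightarrow> store \<Rightarrow> bool" where
  Write: "exec (Write a e e') s 1 (s(a := (s a)(val e s := val e' s)))"
| Seq: "exec c s t s' \<Longrightarrow> exec c' s' t' s'' \<Longrightarrow> exec (Seq c c') s (t + t') s''"
| IfTrue: "val e s \<noteq> 0 \<Longrightarrow> exec c s t s' \<Longrightarrow> exec (If e c c') s (t + 1) s'"
| IfFalse: "val e s = 0 \<Longrightarrow> exec c' s t s' \<Longrightarrow> exec (If e c c') s (t + 1) s'"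
| WhileFalse: "val e s = 0 \<Longrightarrow> exec (While e c) s 1 s"
| WhileTrue: "val e s \<noteq> 0 \<Longrightarrow> exec c s t s' \<Longrightarrow> exec (While e c) s' t' s'' \<Longrightarrow>
    exec (While e c) s (t + t' + 1) s''"

inductive_cases WriteE: "exec (Write a e e') s t s'"
inductive_cases SeqE: "exec (Seq c c') s t s'"
inductive_cases IfE: "exec (If e c c') s t s'"
inductive_cases WhileE: "exec (While e c) s t s'"

lemma exec_deterministic:
  "exec c s t s' \<Longrightarrow> exec c s u s'' \<Longrightarrow> t = u \<and> s' = s''"
proof (induction arbitrary: u s'' rule: exec.induct)
  case Write
  then show ?case by (elim WriteE) simp
next
  case (Seq c s t s1 c' t' s2)
  from Seq.prems show ?case
    by (rule SeqE) (metis Seq.IH)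
next
  case (IfTrue e s c t s1 c')
  from IfTrue.prems show ?case
    by (rule IfE) (metis IfTrue.IH IfTrue.hyps(1) Suc_eq_plus1 neq0_conv)+
next
  case (IfFalse e s c' t s1 c)
  from IfFalse.prems show ?case
    by (rule IfE) (metis IfFalse.IH IfFalse.hyps(1) Suc_eq_plus1 neq0_conv)+
next
  case (WhileFalse e s c)
  from WhileFalse.prems show ?case
    by (rule WhileE) (use WhileFalse.hyps in simp_all)
next
  case (WhileTrue e s c t s1 t' s2)
  from WhileTrue.prems show ?case
    by (rule WhileE) (metis WhileTrue.IH WhileTrue.hyps(1) Suc_eq_plus1 neq0_conv)+
qed

text \<open>
  Array 0 initially holds the input, all other cells hold 0; the output is read off array 1.
  All numbers in the input are bounded by its length, so polynomial in the number of input words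
  is the same as polynomial in the number of input bits.
\<close>

definition encode :: "election \<Rightarrow> nat list" where
  "encode E = [num_voters E, num_cands E, horizon E] @ voter_order E @ concat (concat (rankings E))"

definition input_store :: "nat list \<Rightarrow> store" where
  "input_store xs = (\<lambda>a i. if a = 0 \<and> i < length xs then xs ! i else 0)"

definition polynomial_time :: "(election \<Rightarrow> nat list) \<Rightarrow> bool" where
  "polynomial_time f \<longleftrightarrow> (\<exists>(c :: com) (p :: nat poly). \<forall>E. valid_election E \<longrightarrow>
     (\<exists>t s. exec c (input_store (encode E)) t s \<and>
        t \<le> poly p (length (encode E)) \<and>
        map (s 1) [0..<horizon E] = f E))"

end

theory Submission
  imports Defs
begin

text \<open>
  Under single crossing a solid group may be replaced by the interval of the voter order that it
  spans, and then only the smallest common prefix set X(I) of the rankings at the two endpoints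
  of the interval I matters: I must be satisfied often enough, where a winner satisfies I if it lies in X(I).
  Each demand of I has a deadline, and the initial demands can be scheduled: for every t, pairwise disjoint
  intervals have at most t demands with deadline up to t. The rule keeps the remaining demands
  schedulable in this sense. In each round it starts with Y = C and, as long as some X(I) is a proper subset
  of Y, replaces Y by the X(I) of such an I with the earliest deadline; an element of the final Y
  wins. Single crossing makes X(I) and X(J) comparable for overlapping I and J, since both are
  prefixes of the ranking of a common voter. A disjoint family without slack at time t must overlap each of the
  chosen intervals with deadline up to t, so it keeps containing an interval that is either satisfied or
  allows Y to shrink further. Deadlines are compared through the quotients (count + 1) / length and do not
  involve the horizon, so the rule is online, and the Droop requirement implies the original one.
\<close>

section \<open>The rule\<close>

text \<open>The lower bound 1 excludes the trivial agreement of empty prefixes. Rankings of the same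
  \<open>m\<close> candidates agree at \<open>m\<close>, so the minimum exists.\<close>

definition common_rank :: "nat list \<Rightarrow> nat list \<Rightarrow> nat" where
  "common_rank \<rho> \<rho>' = (LEAST r. 1 \<le> r \<and> set (take r \<rho>) = set (take r \<rho>'))"

definition common_top :: "(nat \<Rightarrow> nat list) \<Rightarrow> nat \<Rightarrow> nat \<Rightarrow> nat set" where
  "common_top P a b = set (take (common_rank (P a) (P b)) (P a))"

text \<open>A pair \<open>(ya, yr)\<close> stands for the set of the \<open>yr\<close> favourites of the voter at position \<open>ya\<close>. The
  quotient \<open>bs / bl\<close> is the least value of \<open>(\<gamma> a b + 1) / (b + 1 - a)\<close> seen so far, which orders the
  intervals by deadline; \<open>bl = 0\<close> stands for infinity. For \<open>b < a\<close> the truncated length \<open>Suc b - a\<close>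
  is 0 and the pair is never selected.\<close>

definition improve ::
  "(nat \<Rightarrow> nat list) \<Rightarrow> (nat \<Rightarrow> nat \<Rightarrow> nat) \<Rightarrow> nat \<times> nat \<Rightarrow> nat \<times> nat \<Rightarrow>
    nat \<times> nat \<times> nat \<times> nat \<Rightarrow> nat \<times> nat \<times> nat \<times> nat" where
  "improve P \<gamma> = (\<lambda>(ya, yr) (a, b) (bs, bl, ba, br).
     if common_top P a b \<subset> set (take yr (P ya)) \<and> Suc (\<gamma> a b) * bl < bs * (Suc b - a)
     then (Suc (\<gamma> a b), Suc b - a, a, common_rank (P a) (P b)) else (bs, bl, ba, br))"

definition shrink :: "nat \<Rightarrow> (nat \<Rightarrow> nat list) \<Rightarrow> (nat \<Rightarrow> nat \<Rightarrow> nat) \<Rightarrow> nat \<times> nat \<Rightarrow> nat \<times> nat" where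
  "shrink n P \<gamma> y =
     (case fold (improve P \<gamma> y) (List.product [0..<n] [0..<n]) (1, 0, 0, 0) of
        (bs, bl, ba, br) \<Rightarrow> if bl = 0 then y else (ba, br))"

text \<open>The start \<open>(0, m)\<close> represents all candidates. Every effective shrinking
  lowers the rank, so \<open>m\<close> iterations reach a fixed point. Its rank is still positive,
  so the favourite of the voter at \<open>ya\<close> belongs to the represented set.\<close>

definition winner :: "nat \<Rightarrow> nat \<Rightarrow> (nat \<Rightarrow> nat list) \<Rightarrow> (nat \<Rightarrow> nat \<Rightarrow> nat) \<Rightarrow> nat" where
  "winner n m P \<gamma> = P (fst ((shrink n P \<gamma> ^^ m) (0, m))) ! 0"

primrec counts :: "nat \<Rightarrow> nat \<Rightarrow> (nat \<Rightarrow> nat \<Rightarrow> nat list) \<Rightarrow> nat \<Rightarrow> nat \<Rightarrow> nat \<Rightarrow> nat" where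
  "counts n m Q 0 = (\<lambda>a b. 0)"
| "counts n m Q (Suc j) = (\<lambda>a b. counts n m Q j a b +
     of_bool (winner n m (Q j) (counts n m Q j) \<in> common_top (Q j) a b))"

text \<open>Voters are re-indexed by their position in the given order, so that contiguous groups
  become intervals of numbers.\<close>

definition profile :: "election \<Rightarrow> nat \<Rightarrow> nat \<Rightarrow> nat list" where
  "profile E j a = rankings E ! j ! (voter_order E ! a)"

definition edf_rule :: "election \<Rightarrow> nat list" where
  "edf_rule E = map (\<lambda>j. winner (num_voters E) (num_cands E) (profile E j)
     (counts (num_voters E) (num_cands E) (profile E) j)) [0..<horizon E]"

section \<open>Feasible demands\<close>

definition intervals :: "nat \<Rightarrow> (nat \<times> nat) set" where
  "intervals n = {(a, b). a \<le> b \<and> b < n}"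

text \<open>This is \<open>\<lceil>L (t + 1) / n\<rceil> - 1\<close> for an interval of length \<open>L\<close>, the largest integer \<open>k\<close> with
  \<open>L > k n / (t + 1)\<close>.\<close>

definition demand :: "nat \<Rightarrow> nat \<Rightarrow> nat \<times> nat \<Rightarrow> nat" where
  "demand n t = (\<lambda>(a, b). ((Suc b - a) * Suc t - 1) div n)"

definition interval_family :: "nat \<Rightarrow> (nat \<times> nat) set \<Rightarrow> bool" where
  "interval_family n F \<longleftrightarrow> F \<subseteq> intervals n \<and>
     disjoint_family_on (\<lambda>I. {fst I..snd I}) F"

text \<open>The condition for \<open>t = T\<close> and a single interval says that no demand has been missed; the
  quantification over later \<open>t\<close> and over families is what makes the condition inductive.\<close>

definition feasible :: "nat \<Rightarrow> nat \<Rightarrow> (nat \<Rightarrow> nat \<Rightarrow> nat) \<Rightarrow> bool" where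
  "feasible n T \<gamma> \<longleftrightarrow> (\<forall>t F. T \<le> t \<longrightarrow> interval_family n F \<longrightarrow>
     (\<Sum>I\<in>F. int (demand n t I) - int (case_prod \<gamma> I)) \<le> int t - int T)"

lemma finite_intervals: "finite (intervals n)"
  by (rule finite_subset[of _ "{..<n} \<times> {..<n}"]) (auto simp: intervals_def)

lemma interval_family_subset: "interval_family n F \<Longrightarrow> G \<subseteq> F \<Longrightarrow> interval_family n G"
  unfolding interval_family_def disjoint_family_on_def by blast

lemma interval_family_finite: "interval_family n F \<Longrightarrow> finite F"
  unfolding interval_family_def using finite_intervals finite_subset by blast

text \<open>Subtracting 1 before rounding down makes the comparison strict. Demand number
  \<open>k + 1\<close> of an interval of length \<open>L\<close> is thus due by time
  \<open>t\<close> exactly if \<open>(k + 1) / L < (t + 1) / n\<close>, and deadlines can be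
  compared through quotients free of the horizon.\<close>

lemma demand_gt_iff:
  assumes "n > 0" "a \<le> b"
  shows "k < demand n t (a, b) \<longleftrightarrow> n * Suc k < (Suc b - a) * Suc t"
proof -
  have "k < demand n t (a, b) \<longleftrightarrow> Suc k * n \<le> (Suc b - a) * Suc t - 1"
    using assms by (simp add: demand_def less_eq_div_iff_mult_less_eq flip: Suc_le_eq)
  also have "(Suc b - a) * Suc t > 0" using assms by simp
  then have "Suc k * n \<le> (Suc b - a) * Suc t - 1 \<longleftrightarrow> Suc k * n < (Suc b - a) * Suc t"
    by linarith
  finally show ?thesis by (simp only: mult.commute)
qed

section \<open>The initial demands can be scheduled\<close>

lemma sum_lengths:
  assumes "interval_family n F"
  shows "(\<Sum>(a, b)\<in>F. Suc b - a) \<le> n"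
proof -
  have "(\<Sum>(a, b)\<in>F. Suc b - a) = (\<Sum>I\<in>F. card {fst I..snd I})"
    by (intro sum.cong) auto
  also have "\<dots> = card (\<Union>I\<in>F. {fst I..snd I})"
    using assms interval_family_finite[OF assms]
    by (intro card_UN_disjoint[symmetric]) (auto simp: interval_family_def disjoint_family_on_def)
  also have "\<dots> \<le> card {..<n}"
    using assms by (intro card_mono) (auto simp: interval_family_def intervals_def)
  finally show ?thesis by simp
qed

text \<open>Rounding down is superadditive, and merging two members replaces two subtractions of 1
  by a single one.\<close>

lemma sum_div_le:
  fixes x :: "'a \<Rightarrow> nat"
  assumes "finite F" "F \<noteq> {}" "\<And>i. i \<in> F \<Longrightarrow> x i \<ge> 1"
  shows "(\<Sum>i\<in>F. (x i - 1) div n) \<le> ((\<Sum>i\<in>F. x i) - 1) div n"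
  using assms
proof (induction F rule: finite_ne_induct)
  case (insert i F)
  have pos: "(\<Sum>i\<in>F. x i) \<ge> 1" "x i \<ge> 1"
    using insert.hyps insert.prems sum_pos[of F x] by (force simp: Suc_le_eq)+
  have "(\<Sum>i\<in>insert i F. (x i - 1) div n) \<le> (x i - 1) div n + ((\<Sum>i\<in>F. x i) - 1) div n"
    using insert by simp
  also have "\<dots> \<le> ((x i - 1) + ((\<Sum>i\<in>F. x i) - 1)) div n"
    by (metis div_add1_eq le_add1)
  also have "\<dots> \<le> ((\<Sum>i\<in>insert i F. x i) - 1) div n"
    using pos insert.hyps by (intro div_le_mono) simp
  finally show ?case .
qed simp

text \<open>Disjoint intervals have total length at most \<open>n\<close>, so by superadditivity
  their joint demand is at most \<open>(n * (t + 1) - 1) div n\<close>, which is below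
  \<open>t + 1\<close>.\<close>

lemma feasible_init:
  assumes "n > 0"
  shows "feasible n 0 (\<lambda>a b. 0)"
  unfolding feasible_def
proof (intro allI impI)
  fix t F assume F: "interval_family n F"
  show "(\<Sum>I\<in>F. int (demand n t I) - int (case I of (a, b) \<Rightarrow> 0)) \<le> int t - int 0"
  proof (cases "F = {}")
    case False
    have "(\<Sum>I\<in>F. demand n t I) = (\<Sum>I\<in>F. ((case I of (a, b) \<Rightarrow> Suc b - a) * Suc t - 1) div n)"
      by (intro sum.cong) (auto simp: demand_def)
    also have "\<dots> \<le> ((\<Sum>I\<in>F. (case I of (a, b) \<Rightarrow> Suc b - a) * Suc t) - 1) div n"
      using F False interval_family_finite[OF F]
      by (intro sum_div_le) (auto simp: interval_family_def intervals_def Suc_diff_le)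
    also have "(\<Sum>I\<in>F. (case I of (a, b) \<Rightarrow> Suc b - a) * Suc t) = (\<Sum>(a, b)\<in>F. Suc b - a) * Suc t"
      by (rule sum_distrib_right[symmetric])
    also have "((\<Sum>(a, b)\<in>F. Suc b - a) * Suc t - 1) div n \<le> (n * Suc t - 1) div n"
      by (intro div_le_mono diff_le_mono mult_right_mono sum_lengths[OF F]) simp
    also have "\<dots> \<le> t"
      using assms by (simp add: div_less_iff_less_mult algebra_simps flip: less_Suc_eq_le)
    finally have "(\<Sum>I\<in>F. demand n t I) \<le> t" .
    then have "(\<Sum>I\<in>F. int (demand n t I)) \<le> int t"
      by (metis of_nat_le_iff of_nat_sum)
    then show ?thesis by (simp add: case_prod_beta)
  qed simp
qed

text \<open>Such a family needs every one of the \<open>t - T\<close> rounds left up to time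
  \<open>t\<close>, so the coming round has to satisfy one of its members.\<close>

definition tight :: "nat \<Rightarrow> nat \<Rightarrow> (nat \<Rightarrow> nat \<Rightarrow> nat) \<Rightarrow> nat \<Rightarrow> (nat \<times> nat) set \<Rightarrow> bool" where
  "tight n T \<gamma> t F \<longleftrightarrow> T < t \<and> interval_family n F \<and>
     (\<forall>I\<in>F. case_prod \<gamma> I < demand n t I) \<and>
     (\<Sum>I\<in>F. int (demand n t I) - int (case_prod \<gamma> I)) = int t - int T"

text \<open>A round costs every family one unit of slack. A satisfied member repays it. Without a
  satisfied member, the members with outstanding demand do not form a tight family, so there was
  slack to spare.\<close>

lemma feasible_Suc:
  assumes feas: "feasible n T \<gamma>"
    and hit: "\<And>t F. tight n T \<gamma> t F \<Longrightarrow> \<exists>(a, b)\<in>F. sat a b"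
  shows "feasible n (Suc T) (\<lambda>a b. \<gamma> a b + of_bool (sat a b))"
  unfolding feasible_def
proof (intro allI impI)
  fix t F assume t: "Suc T \<le> t" and F: "interval_family n F"
  let ?d = "\<lambda>I. int (demand n t I) - int (case_prod \<gamma> I)"
  let ?G = "{I\<in>F. case_prod \<gamma> I < demand n t I}"
  have fin: "finite F" using F by (rule interval_family_finite)
  have eq: "(\<Sum>I\<in>F. int (demand n t I) - int (case I of (a, b) \<Rightarrow> \<gamma> a b + of_bool (sat a b)))
      = sum ?d F - (\<Sum>I\<in>F. of_bool (case_prod sat I))"
    by (simp add: sum_subtractf[symmetric] case_prod_beta diff_diff_eq)
  have le: "sum ?d F \<le> int t - int T"
    using feas t F unfolding feasible_def by auto
  have "sum ?d F - (\<Sum>I\<in>F. of_bool (case_prod sat I)) \<le> int t - int (Suc T)"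
  proof (cases "\<exists>I\<in>F. case_prod sat I")
    case True
    then obtain I where I: "I \<in> F" "case_prod sat I" by blast
    have "(\<Sum>I\<in>F. of_bool (case_prod sat I) :: int) \<ge> of_bool (case_prod sat I)"
      using fin I by (intro member_le_sum) auto
    then show ?thesis using le I by simp
  next
    case False
    \<comment> \<open>Members without outstanding demand contribute at most 0, so discarding them
      does not lower the sum.\<close>
    have "sum ?d F \<le> (\<Sum>I\<in>F. if case_prod \<gamma> I < demand n t I then ?d I else 0)"
      by (intro sum_mono) auto
    also have "\<dots> = sum ?d ?G"
      using fin by (rule sum.inter_filter[symmetric])
    finally have "sum ?d F \<le> sum ?d ?G" .
    moreover have "sum ?d ?G \<le> int t - int T"
      using feas t interval_family_subset[OF F, of ?G] unfolding feasible_def by auto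
    moreover have "\<not> tight n T \<gamma> t ?G"
      using hit[of t ?G] False by auto
    then have "sum ?d ?G \<noteq> int t - int T"
      using t interval_family_subset[OF F, of ?G] unfolding tight_def by auto
    moreover have "(\<Sum>I\<in>F. of_bool (case_prod sat I) :: int) \<ge> 0"
      by (intro sum_nonneg) simp
    ultimately show ?thesis by linarith
  qed
  then show "(\<Sum>I\<in>F. int (demand n t I) - int (case I of (a, b) \<Rightarrow> \<gamma> a b + of_bool (sat a b)))
      \<le> int t - int (Suc T)"
    unfolding eq .
qed

text \<open>The invariant of the shrinking process. A member containing \<open>Y\<close> is
  satisfied by any winner from \<open>Y\<close>; a member properly inside \<open>Y\<close> shows
  that shrinking has not ended.\<close>

definition hits_tight :: "nat \<Rightarrow> nat \<Rightarrow> (nat \<Rightarrow> nat \<Rightarrow> nat) \<Rightarrow> (nat \<Rightarrow> nat \<Rightarrow> nat set) \<Rightarrow> nat set \<Rightarrow> bool" where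
  "hits_tight n T \<gamma> X Y \<longleftrightarrow> (\<forall>t F. tight n T \<gamma> t F \<longrightarrow>
     (\<exists>(a, b)\<in>F. Y \<subseteq> X a b \<or> X a b \<subset> Y))"

lemma hits_tight_init:
  assumes "\<And>a b. a < n \<Longrightarrow> b < n \<Longrightarrow> X a b \<subseteq> Y"
  shows "hits_tight n T \<gamma> X Y"
  unfolding hits_tight_def
proof (intro allI impI)
  fix t F assume F: "tight n T \<gamma> t F"
  \<comment> \<open>The empty family has sum 0, whereas \<open>T < t\<close> makes the sum of a
    tight family positive.\<close>
  then have "F \<noteq> {}" by (auto simp: tight_def)
  then obtain a b where "(a, b) \<in> F" by auto
  moreover from this have "X a b \<subseteq> Y"
    using F by (intro assms) (auto simp: tight_def interval_family_def intervals_def)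
  ultimately show "\<exists>(a, b)\<in>F. Y \<subseteq> X a b \<or> X a b \<subset> Y" by auto
qed

text \<open>The minimal interval \<open>[c, d]\<close> has demand left at the time at which \<open>F\<close> is tight, so it cannot be
  disjoint from all members of \<open>F\<close>: adding it would violate feasibility.\<close>

lemma hits_tight_step:
  assumes "n > 0" and feas: "feasible n T \<gamma>"
    and hits: "hits_tight n T \<gamma> X Y"
    and comparable: "\<And>a b c d p. a \<le> p \<Longrightarrow> p \<le> b \<Longrightarrow> b < n \<Longrightarrow> c \<le> p \<Longrightarrow> p \<le> d \<Longrightarrow> d < n \<Longrightarrow>
      X a b \<subseteq> X c d \<or> X c d \<subseteq> X a b"
    and c: "c \<le> d" "d < n" "X c d \<subset> Y"
    and min: "\<And>a b. a \<le> b \<Longrightarrow> b < n \<Longrightarrow> X a b \<subset> Y \<Longrightarrow>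
      Suc (\<gamma> c d) * (Suc b - a) \<le> Suc (\<gamma> a b) * (Suc d - c)"
  shows "hits_tight n T \<gamma> X (X c d)"
  unfolding hits_tight_def
proof (intro allI impI)
  fix t F assume tight: "tight n T \<gamma> t F"
  then have F: "interval_family n F" and fin: "finite F"
    by (auto simp: tight_def interval_family_finite)
  from hits tight obtain a b where ab: "(a, b) \<in> F" "Y \<subseteq> X a b \<or> X a b \<subset> Y"
    unfolding hits_tight_def by blast
  show "\<exists>(a, b)\<in>F. X c d \<subseteq> X a b \<or> X a b \<subset> X c d"
  proof (cases "Y \<subseteq> X a b")
    case True
    then have "X c d \<subseteq> X a b" using c(3) by blast
    then show ?thesis using ab(1) by blast
  next
    case False
    have le: "a \<le> b" "b < n"
      using F ab(1) by (auto simp: interval_family_def intervals_def)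
    have "n * Suc (\<gamma> a b) < (Suc b - a) * Suc t"
      using tight ab(1) demand_gt_iff[OF \<open>n > 0\<close> le(1)] by (auto simp: tight_def)
    \<comment> \<open>Combining this deadline inequality for \<open>(a, b)\<close> with the
      minimality of the quotient of \<open>(c, d)\<close> shows, after cancelling, that the next
      demand of \<open>(c, d)\<close> is also due by \<open>t\<close>.\<close>
    then have "n * Suc (\<gamma> a b) * (Suc d - c) < (Suc b - a) * Suc t * (Suc d - c)"
      using c by (intro mult_strict_right_mono) auto
    moreover have "Suc (\<gamma> c d) * (Suc b - a) \<le> Suc (\<gamma> a b) * (Suc d - c)"
      using min[OF le] ab(2) False by blast
    then have "n * (Suc (\<gamma> c d) * (Suc b - a)) \<le> n * (Suc (\<gamma> a b) * (Suc d - c))"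
      by (intro mult_left_mono) auto
    ultimately have "(Suc b - a) * (n * Suc (\<gamma> c d)) < (Suc b - a) * ((Suc d - c) * Suc t)"
      by (simp only: ac_simps)
    then have "n * Suc (\<gamma> c d) < (Suc d - c) * Suc t"
      by (simp only: mult_less_cancel1)
    then have due: "\<gamma> c d < demand n t (c, d)"
      using demand_gt_iff[OF \<open>n > 0\<close> c(1)] by blast
    have "\<exists>I\<in>F. {fst I..snd I} \<inter> {c..d} \<noteq> {}"
    proof (rule ccontr)
      assume "\<not> ?thesis"
      then have disj: "\<And>I. I \<in> F \<Longrightarrow> {fst I..snd I} \<inter> {c..d} = {}" by blast
      then have "(c, d) \<notin> F" using c(1) by fastforce
      have "interval_family n (insert (c, d) F)"
        using F disj c unfolding interval_family_def disjoint_family_on_def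
        by (auto simp: intervals_def Int_commute)
      then have "(\<Sum>I\<in>insert (c, d) F. int (demand n t I) - int (case_prod \<gamma> I)) \<le> int t - int T"
        using feas tight by (auto simp: feasible_def tight_def)
      then show False
        using tight due fin \<open>(c, d) \<notin> F\<close> by (simp add: tight_def)
    qed
    \<comment> \<open>The two intervals share the position \<open>p\<close>, so their sets are
      comparable, and either direction of inclusion gives one of the required alternatives.\<close>
    then obtain a' b' p where I: "(a', b') \<in> F" "a' \<le> p" "p \<le> b'" "c \<le> p" "p \<le> d" by fastforce
    then have "b' < n" using F by (auto simp: interval_family_def intervals_def)
    with I c(2) comparable[of a' p b' c d] show ?thesis by blast
  qed
qed

section \<open>Rankings\<close>

lemma perm_length: "\<rho> \<in> permutations_of_set {..<m} \<Longrightarrow> length \<rho> = m"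
  using length_finite_permutations_of_set by fastforce

lemma perm_distinct: "\<rho> \<in> permutations_of_set A \<Longrightarrow> distinct \<rho>"
  by (rule permutations_of_setD)

lemma perm_set: "\<rho> \<in> permutations_of_set A \<Longrightarrow> set \<rho> = A"
  by (rule permutations_of_setD)

lemma perm_nth_less: "\<rho> \<in> permutations_of_set {..<m} \<Longrightarrow> k < m \<Longrightarrow> \<rho> ! k < m"
  using perm_length perm_set nth_mem by blast

lemma card_set_take:
  "distinct \<rho> \<Longrightarrow> r \<le> length \<rho> \<Longrightarrow> card (set (take r \<rho>)) = r"
  by (simp add: distinct_card)

lemma nth_in_take_iff:
  assumes "distinct \<rho>" "k < length \<rho>"
  shows "\<rho> ! k \<in> set (take r \<rho>) \<longleftrightarrow> k < r"
  using assms by (auto simp: in_set_conv_nth nth_eq_iff_index_eq)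

context
  fixes m :: nat and \<rho> \<rho>' :: "nat list"
  assumes m: "m \<ge> 1"
    and perm: "\<rho> \<in> permutations_of_set {..<m}" "\<rho>' \<in> permutations_of_set {..<m}"
begin

lemma common_rank_props:
  "1 \<le> common_rank \<rho> \<rho>'" "common_rank \<rho> \<rho>' \<le> m"
  "set (take (common_rank \<rho> \<rho>') \<rho>) = set (take (common_rank \<rho> \<rho>') \<rho>')"
proof -
  have ex: "1 \<le> m \<and> set (take m \<rho>) = set (take m \<rho>')"
    using m perm by (simp add: perm_length perm_set)
  from LeastI[of "\<lambda>r. 1 \<le> r \<and> set (take r \<rho>) = set (take r \<rho>')", OF ex]
  show "1 \<le> common_rank \<rho> \<rho>'"
    "set (take (common_rank \<rho> \<rho>') \<rho>) = set (take (common_rank \<rho> \<rho>') \<rho>')"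
    by (auto simp: common_rank_def)
  show "common_rank \<rho> \<rho>' \<le> m"
    unfolding common_rank_def by (rule Least_le) (rule ex)
qed

lemma common_rank_le:
  "1 \<le> r \<Longrightarrow> set (take r \<rho>) = set (take r \<rho>') \<Longrightarrow> common_rank \<rho> \<rho>' \<le> r"
  unfolding common_rank_def by (rule Least_le) auto

end

lemma set_take_eqI:
  assumes "distinct \<rho>" "distinct \<rho>'" "r \<le> length \<rho>" "r \<le> length \<rho>'"
    and "set (take r \<rho>) \<subseteq> set (take r \<rho>')"
  shows "set (take r \<rho>) = set (take r \<rho>')"
  by (rule card_subset_eq) (use assms in \<open>simp_all add: card_set_take\<close>)

lemma prefersI:
  assumes "distinct \<rho>" "a \<in> set (take r \<rho>)" "b \<in> set \<rho>" "b \<notin> set (take r \<rho>)"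
  shows "prefers \<rho> a b" "\<not> prefers \<rho> b a"
proof -
  from assms obtain k l where kl: "k < length \<rho>" "k < r" "\<rho> ! k = a" "l < length \<rho>" "\<rho> ! l = b"
    by (auto simp: in_set_conv_nth)
  then have "\<not> l < r" using assms nth_in_take_iff by blast
  then have "k < l" using kl by simp
  then show "prefers \<rho> a b" unfolding prefers_def using kl by blast
  show "\<not> prefers \<rho> b a"
    unfolding prefers_def using kl \<open>k < l\<close> assms(1) by (auto simp: nth_eq_iff_index_eq)
qed

section \<open>Single crossing and comparable prefix sets\<close>

lemma profile_perm:
  assumes "valid_election E" "j < horizon E" "a < num_voters E"
  shows "profile E j a \<in> permutations_of_set {..<num_cands E}"
proof -
  have "voter_order E ! a < num_voters E"
    using assms perm_nth_less unfolding valid_election_def by blast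
  then show ?thesis
    using assms unfolding valid_election_def profile_def horizon_def
    by (metis nth_mem)
qed

text \<open>If some candidate separated the top sets of \<open>p\<close> and of the endpoints, then the voters
  preferring one candidate to another would include both endpoints but not \<open>p\<close>.\<close>

lemma top_set_between:
  assumes valid: "valid_election E" and sc: "single_crossing E" and j: "j < horizon E"
    and ord: "a \<le> p" "p \<le> b" "b < num_voters E"
    and r: "r \<le> num_cands E"
    and eq: "set (take r (profile E j a)) = set (take r (profile E j b))"
  shows "set (take r (profile E j p)) = set (take r (profile E j a))"
proof (rule ccontr)
  assume neq: "\<not> ?thesis"
  let ?m = "num_cands E" and ?n = "num_voters E" and ?P = "profile E j" and ?\<sigma> = "voter_order E"
  have perm: "?P i \<in> permutations_of_set {..<?m}" if "i < ?n" for i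
    using profile_perm[OF valid j that] .
  have dist: "distinct (?P i)" and len: "length (?P i) = ?m" and set: "set (?P i) = {..<?m}"
    if "i < ?n" for i
    using perm[OF that] by (auto simp: perm_distinct perm_length perm_set)
  have less: "a < ?n" "p < ?n" "b < ?n" using ord by auto
  have \<sigma>: "distinct ?\<sigma>" "length ?\<sigma> = ?n" "set ?\<sigma> = {..<?n}"
    using valid unfolding valid_election_def by (auto simp: perm_distinct perm_length perm_set)
  \<comment> \<open>Two distinct sets of the same size \<open>r\<close> do not contain each other,
    so each has an element missing from the other.\<close>
  have "\<not> set (take r (?P p)) \<subseteq> set (take r (?P a))"
    using neq set_take_eqI[OF dist[OF less(2)] dist[OF less(1)], of r] less len r by auto
  then obtain y where y: "y \<in> set (take r (?P p))" "y \<notin> set (take r (?P a))" by blast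
  have "\<not> set (take r (?P a)) \<subseteq> set (take r (?P p))"
    using neq set_take_eqI[OF dist[OF less(1)] dist[OF less(2)], of r] less len r by auto
  then obtain x where x: "x \<in> set (take r (?P a))" "x \<notin> set (take r (?P p))" by blast
  have xy: "x < ?m" "y < ?m"
    using x(1) y(1) less set by (auto dest!: in_set_takeD)
  have pref: "prefers (?P a) x y" "prefers (?P b) x y" "\<not> prefers (?P p) x y"
    using prefersI(1)[OF dist[OF less(1)] x(1) _ y(2)] prefersI(1)[OF dist[OF less(3)], of x r y]
      prefersI(2)[OF dist[OF less(2)] y(1) _ x(2)] x y eq xy less set by auto
  define X where "X = {i. i < ?n \<and> prefers (rankings E ! j ! i) x y}"
  have mem: "?\<sigma> ! i \<in> X \<longleftrightarrow> prefers (?P i) x y" if "i < ?n" for i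
    using that \<sigma> nth_mem[of i ?\<sigma>] by (auto simp: X_def profile_def)
  have "\<exists>k. X = set (take k ?\<sigma>) \<or> X = set (drop k ?\<sigma>)"
    using sc j xy unfolding single_crossing_def single_crossing_round_def X_def Let_def by blast
  then obtain k where "X = set (take k ?\<sigma>) \<or> X = set (drop k ?\<sigma>)" by blast
  moreover have "?\<sigma> ! i \<in> set (drop k ?\<sigma>) \<longleftrightarrow> k \<le> i" if "i < ?n" for i
  proof -
    have "set (take k ?\<sigma>) \<inter> set (drop k ?\<sigma>) = {}" "set (take k ?\<sigma>) \<union> set (drop k ?\<sigma>) = set ?\<sigma>"
      using \<sigma>(1) by (simp add: set_take_disj_set_drop_if_distinct)
        (metis append_take_drop_id set_append)
    then show ?thesis
      using that \<sigma> nth_in_take_iff[of ?\<sigma> i k] nth_mem[of i ?\<sigma>] by auto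
  qed
  moreover have "?\<sigma> ! i \<in> set (take k ?\<sigma>) \<longleftrightarrow> i < k" if "i < ?n" for i
    using that \<sigma> by (simp add: nth_in_take_iff)
  ultimately show False
    using pref mem less ord by auto
qed

text \<open>By \<open>top_set_between\<close> at the common rank of the endpoints, both sets are top
  sets of the voter at the shared position \<open>p\<close>, and the top sets of one ranking form a
  chain.\<close>

lemma common_top_comparable:
  assumes "valid_election E" "single_crossing E" "j < horizon E"
    and "a \<le> p" "p \<le> b" "b < num_voters E" "c \<le> p" "p \<le> d" "d < num_voters E"
  shows "common_top (profile E j) a b \<subseteq> common_top (profile E j) c d \<or>
    common_top (profile E j) c d \<subseteq> common_top (profile E j) a b"
proof -
  have "common_top (profile E j) a' b' =
      set (take (common_rank (profile E j a') (profile E j b')) (profile E j p))"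
    if "a' \<le> p" "p \<le> b'" "b' < num_voters E" for a' b'
  proof -
    have perm: "profile E j a' \<in> permutations_of_set {..<num_cands E}"
      "profile E j b' \<in> permutations_of_set {..<num_cands E}"
      using profile_perm[OF assms(1,3)] that by auto
    have m: "num_cands E \<ge> 1" using assms(1) by (simp add: valid_election_def)
    show ?thesis
      unfolding common_top_def
      using top_set_between[OF assms(1-3) that common_rank_props(2,3)[OF m perm]] by simp
  qed
  then show ?thesis
    using assms(4-9) set_take_subset_set_take by (metis linear)
qed

section \<open>Correctness of the rule\<close>

text \<open>The fold computes a minimum of quotients by cross multiplication. This case rule is the
  interface to it for the scheduling argument.\<close>

lemma shrink_cases:
  obtains
    (stop) "shrink n P \<gamma> (ya, yr) = (ya, yr)"
      "\<And>a b. a \<le> b \<Longrightarrow> b < n \<Longrightarrow> \<not> common_top P a b \<subset> set (take yr (P ya))"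
  | (step) c d where "shrink n P \<gamma> (ya, yr) = (c, common_rank (P c) (P d))" "c \<le> d" "d < n"
      "common_top P c d \<subset> set (take yr (P ya))"
      "\<And>a b. a \<le> b \<Longrightarrow> b < n \<Longrightarrow> common_top P a b \<subset> set (take yr (P ya)) \<Longrightarrow>
        Suc (\<gamma> c d) * (Suc b - a) \<le> Suc (\<gamma> a b) * (Suc d - c)"
proof -
  let ?Y = "set (take yr (P ya))"
  \<comment> \<open>Invariant for the set \<open>S\<close> of pairs scanned so far: the record is
    infinity or stems from a proper interval in \<open>S\<close>, and its quotient is at most that
    of each eligible pair in \<open>S\<close>. For \<open>b < a\<close> the bound holds since the
    truncated length is 0.\<close>
  define good where "good S z \<longleftrightarrow> (case z of (bs, bl, ba, br) \<Rightarrow>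
      (bl = 0 \<and> bs = 1 \<or> (\<exists>c d. c \<le> d \<and> (c, d) \<in> S \<and> common_top P c d \<subset> ?Y \<and>
         bs = Suc (\<gamma> c d) \<and> bl = Suc d - c \<and> ba = c \<and> br = common_rank (P c) (P d))) \<and>
      (\<forall>(a, b)\<in>S. common_top P a b \<subset> ?Y \<longrightarrow> bs * (Suc b - a) \<le> Suc (\<gamma> a b) * bl))" for S z
  have good_improve: "good (insert (a, b) S) (improve P \<gamma> (ya, yr) (a, b) z)" if g: "good S z" for a b S z
  proof (cases z)
    case (fields bs bl ba br)
    show ?thesis
    proof (cases "common_top P a b \<subset> ?Y \<and> Suc (\<gamma> a b) * bl < bs * (Suc b - a)")
      case True
      then have less: "Suc (\<gamma> a b) * bl < bs * (Suc b - a)" by blast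
      then have "a \<le> b" by (cases "a \<le> b") auto
      have "Suc (\<gamma> a b) * (Suc b' - a') \<le> Suc (\<gamma> a' b') * (Suc b - a)"
        if "(a', b') \<in> S" "common_top P a' b' \<subset> ?Y" for a' b'
      proof -
        have "bs * (Suc b' - a') \<le> Suc (\<gamma> a' b') * bl"
          using g that fields by (auto simp: good_def)
        \<comment> \<open>Transitivity of the order of quotients without division: chain through the
          old record and cancel \<open>bs\<close>, which is positive.\<close>
        then have "Suc (\<gamma> a b) * (bs * (Suc b' - a')) \<le> Suc (\<gamma> a b) * (Suc (\<gamma> a' b') * bl)"
          by (rule mult_left_mono) simp
        also have "\<dots> = Suc (\<gamma> a' b') * (Suc (\<gamma> a b) * bl)" by (simp only: ac_simps)
        also have "\<dots> \<le> Suc (\<gamma> a' b') * (bs * (Suc b - a))"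
          using less by (intro mult_left_mono) auto
        finally have "bs * (Suc (\<gamma> a b) * (Suc b' - a')) \<le> bs * (Suc (\<gamma> a' b') * (Suc b - a))"
          by (simp only: ac_simps)
        moreover have "bs > 0" using less by (cases bs) auto
        ultimately show ?thesis by (simp only: mult_le_cancel1)
      qed
      then show ?thesis
        using True \<open>a \<le> b\<close> fields by (auto simp: good_def improve_def)
    next
      case False
      then have "improve P \<gamma> (ya, yr) (a, b) z = z"
        using fields by (auto simp: improve_def)
      moreover have "common_top P a b \<subset> ?Y \<longrightarrow> bs * (Suc b - a) \<le> Suc (\<gamma> a b) * bl"
        using False by (simp only: de_Morgan_conj not_less) blast
      ultimately show ?thesis
        using g unfolding fields good_def prod.case by (simp only: ball_simps prod.case) blast
    qed
  qed
  have "good (S \<union> set xs) (fold (improve P \<gamma> (ya, yr)) xs z)" if "good S z" for xs S z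
    using that
  proof (induction xs arbitrary: S z)
    case (Cons x xs)
    obtain a b where "x = (a, b)" by (cases x)
    then show ?case using Cons.IH[OF good_improve[OF Cons.prems, of a b]] by simp
  qed simp
  from this[of "{}" "(1, 0, 0, 0)" "List.product [0..<n] [0..<n]"]
  have good: "good ({..<n} \<times> {..<n}) (fold (improve P \<gamma> (ya, yr)) (List.product [0..<n] [0..<n]) (1, 0, 0, 0))"
    by (simp add: good_def lessThan_atLeast0)
  obtain bs bl ba br where
    z: "fold (improve P \<gamma> (ya, yr)) (List.product [0..<n] [0..<n]) (1, 0, 0, 0) = (bs, bl, ba, br)"
    by (rule prod_cases4)
  have bound: "bs * (Suc b - a) \<le> Suc (\<gamma> a b) * bl"
    if "a < n" "b < n" "common_top P a b \<subset> ?Y" for a b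
    using good that unfolding z good_def by blast
  show thesis
  proof (cases "bl = 0")
    case True
    \<comment> \<open>Here \<open>bl = 0\<close> forces \<open>bs = 1\<close>, so the bound would
      say that an eligible interval has length 0.\<close>
    have *: "\<not> common_top P a b \<subset> ?Y" if "a \<le> b" "b < n" for a b
      using good that True bound[of a b] unfolding z by (auto simp: good_def)
    show thesis by (rule stop) (use * z True in \<open>auto simp: shrink_def\<close>)
  next
    case False
    then obtain c d where *: "c \<le> d" "d < n" "common_top P c d \<subset> ?Y" "bs = Suc (\<gamma> c d)"
        "bl = Suc d - c" "ba = c" "br = common_rank (P c) (P d)"
      using good unfolding z by (auto simp: good_def)
    have min: "Suc (\<gamma> c d) * (Suc b - a) \<le> Suc (\<gamma> a b) * (Suc d - c)"
      if "a \<le> b" "b < n" "common_top P a b \<subset> ?Y" for a b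
      using bound[of a b] that * by (simp del: mult_Suc)
    show thesis
      by (rule step[OF _ *(1-3) min]) (use * z False in \<open>auto simp: shrink_def\<close>)
  qed
qed

section \<open>The shrinking process and its winner\<close>

definition admissible :: "nat \<Rightarrow> nat \<Rightarrow> nat \<times> nat \<Rightarrow> bool" where
  "admissible n m = (\<lambda>(ya, yr). ya < n \<and> 1 \<le> yr \<and> yr \<le> m)"

context
  fixes n m :: nat and P :: "nat \<Rightarrow> nat list" and \<gamma> :: "nat \<Rightarrow> nat \<Rightarrow> nat"
  assumes n: "n > 0" and m: "m \<ge> 1"
    and P: "\<And>a. a < n \<Longrightarrow> P a \<in> permutations_of_set {..<m}"
begin

lemma admissible_shrink:
  assumes "admissible n m y"
  shows "admissible n m (shrink n P \<gamma> y)"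
proof (cases y)
  case (Pair ya yr)
  show ?thesis
  proof (cases rule: shrink_cases[where n = n and P = P and \<gamma> = \<gamma> and ya = ya and yr = yr])
    case (step c d)
    then show ?thesis
      using Pair common_rank_props(1,2)[OF m P P, of c d] by (simp add: admissible_def)
  qed (use assms Pair in simp_all)
qed

lemma admissible_iterate: "admissible n m ((shrink n P \<gamma> ^^ k) (0, m))"
proof (induction k)
  case 0
  then show ?case using n m by (simp add: admissible_def)
qed (simp add: admissible_shrink)

lemma winner_less: "winner n m P \<gamma> < m"
  using admissible_iterate[of m] m
  by (auto simp: admissible_def winner_def case_prod_beta intro!: perm_nth_less[OF P])

text \<open>The invariant survives every shrinking. Once no prefix set lies properly inside
  \<open>Y\<close>, only its other alternative remains: some member of the tight family has a set
  containing \<open>Y\<close>, and hence the winner.\<close>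

lemma winner_hits_tight:
  assumes feas: "feasible n T \<gamma>"
    and comparable: "\<And>a b c d p. a \<le> p \<Longrightarrow> p \<le> b \<Longrightarrow> b < n \<Longrightarrow> c \<le> p \<Longrightarrow> p \<le> d \<Longrightarrow> d < n \<Longrightarrow>
      common_top P a b \<subseteq> common_top P c d \<or> common_top P c d \<subseteq> common_top P a b"
    and tight: "tight n T \<gamma> t F"
  shows "\<exists>(a, b)\<in>F. winner n m P \<gamma> \<in> common_top P a b"
proof -
  define Y where "Y = (\<lambda>(ya, yr). set (take yr (P ya)))"
  define final where "final y \<longleftrightarrow> (\<forall>a b. a \<le> b \<longrightarrow> b < n \<longrightarrow> \<not> common_top P a b \<subset> Y y)" for y
  let ?y = "\<lambda>k. (shrink n P \<gamma> ^^ k) (0, m)"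
  \<comment> \<open>The rank drops by at least one per iteration until the set is final. At
    \<open>k = m\<close> the bound would force rank 0, which admissibility forbids.\<close>
  have "hits_tight n T \<gamma> (common_top P) (Y (?y k)) \<and> (final (?y k) \<or> snd (?y k) + k \<le> m)" for k
  proof (induction k)
    case 0
    have "common_top P a b \<subseteq> Y (?y 0)" if "a < n" "b < n" for a b
      using set_take_subset[of _ "P a"] perm_set[OF P[of a]] perm_set[OF P[of 0]]
        perm_length[OF P[of 0]] that n
      by (simp add: common_top_def Y_def)
    then show ?case using hits_tight_init by simp
  next
    case (Suc k)
    obtain ya yr where y: "?y k = (ya, yr)" by fastforce
    have adm: "ya < n" "1 \<le> yr" "yr \<le> m"
      using admissible_iterate[of k] unfolding y by (auto simp: admissible_def)
    show ?case
    proof (cases rule: shrink_cases[where n = n and P = P and \<gamma> = \<gamma> and ya = ya and yr = yr])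
      case stop
      then have "final (ya, yr)" by (simp add: final_def Y_def)
      then show ?thesis using Suc y stop(1) by simp
    next
      case (step c d)
      let ?r = "common_rank (P c) (P d)"
      have cd: "c < n" "d < n" using step by auto
      have eq: "?y (Suc k) = (c, ?r)" using y step(1) by simp
      have Y: "Y (c, ?r) = common_top P c d" by (simp add: Y_def common_top_def)
      have sub: "Y (c, ?r) \<subset> Y (ya, yr)" using step(4) unfolding Y by (simp add: Y_def)
      have "hits_tight n T \<gamma> (common_top P) (common_top P c d)"
      proof (rule hits_tight_step[OF n feas _ comparable step(2,3)])
        show "hits_tight n T \<gamma> (common_top P) (Y (ya, yr))" using Suc.IH y by simp
        show "common_top P c d \<subset> Y (ya, yr)" using sub Y by simp
        show "Suc (\<gamma> c d) * (Suc b - a) \<le> Suc (\<gamma> a b) * (Suc d - c)"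
          if "a \<le> b" "b < n" "common_top P a b \<subset> Y (ya, yr)" for a b
          using step(5)[OF that(1,2)] that(3) unfolding Y_def by blast
      qed
      moreover have "card (Y (c, ?r)) < card (Y (ya, yr))"
        using sub by (rule psubset_card_mono[rotated]) (simp add: Y_def)
      then have "?r < yr"
        using adm cd common_rank_props(2)[OF m P P, of c d]
        by (simp add: Y_def card_set_take perm_distinct[OF P] perm_length[OF P])
      moreover have "\<not> final (ya, yr)"
        using step(2-4) by (auto simp: final_def Y_def)
      ultimately show ?thesis using Suc.IH y eq Y by auto
    qed
  qed
  note inv = this[of m]
  obtain ya yr where y: "?y m = (ya, yr)" by fastforce
  have adm: "ya < n" "1 \<le> yr" "yr \<le> m"
    using admissible_iterate[of m] unfolding y by (auto simp: admissible_def)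
  with inv y have final: "final (ya, yr)" by simp
  have "P ya ! 0 \<in> Y (ya, yr)"
    using adm perm_length[OF P[of ya]] by (simp add: Y_def nth_in_take_iff perm_distinct[OF P])
  then have "winner n m P \<gamma> \<in> Y (ya, yr)" using y by (simp add: winner_def)
  moreover obtain a b where ab: "(a, b) \<in> F" "Y (ya, yr) \<subseteq> common_top P a b \<or> common_top P a b \<subset> Y (ya, yr)"
    using inv y tight unfolding hits_tight_def by force
  moreover have "a \<le> b" "b < n"
    using tight ab(1) by (auto simp: tight_def interval_family_def intervals_def)
  then have "\<not> common_top P a b \<subset> Y (ya, yr)" using final by (simp add: final_def)
  ultimately show ?thesis by blast
qed

end

text \<open>The winner of each round hits all tight families, which preserves feasibility. Single
  crossing enters through the comparability of overlapping intervals.\<close>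

lemma feasible_counts:
  assumes valid: "valid_election E" and sc: "single_crossing E" and "T \<le> horizon E"
  shows "feasible (num_voters E) T (counts (num_voters E) (num_cands E) (profile E) T)"
  using assms(3)
proof (induction T)
  case 0
  then show ?case
    using valid feasible_init by (simp add: valid_election_def)
next
  case (Suc T)
  then have T: "T < horizon E" by simp
  have n: "num_voters E > 0" and m: "num_cands E \<ge> 1"
    using valid by (auto simp: valid_election_def)
  show ?case
    unfolding counts.simps
    using Suc.IH T
    by (intro feasible_Suc winner_hits_tight[OF n m profile_perm[OF valid T]]
      common_top_comparable[OF valid sc T]) auto
qed

lemma counts_eq_card:
  "counts n m Q T a b = card {j. j < T \<and> winner n m (Q j) (counts n m Q j) \<in> common_top (Q j) a b}"
proof (induction T)
  case (Suc T)
  have "{j. j < Suc T \<and> winner n m (Q j) (counts n m Q j) \<in> common_top (Q j) a b} =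
    {j. j < T \<and> winner n m (Q j) (counts n m Q j) \<in> common_top (Q j) a b} \<union>
    (if winner n m (Q T) (counts n m Q T) \<in> common_top (Q T) a b then {T} else {})"
    by (auto simp: less_Suc_eq)
  then show ?case using Suc by simp
qed simp

lemma demand_le_counts:
  assumes "valid_election E" "single_crossing E" "a \<le> b" "b < num_voters E"
  shows "demand (num_voters E) (horizon E) (a, b) \<le>
    counts (num_voters E) (num_cands E) (profile E) (horizon E) a b"
proof -
  have "interval_family (num_voters E) {(a, b)}"
    using assms by (simp add: interval_family_def intervals_def disjoint_family_on_def)
  then show ?thesis
    using feasible_counts[OF assms(1,2) order.refl] unfolding feasible_def by fastforce
qed

section \<open>Online property and proportionality of the rule\<close>

lemma edf_rule_rule: "rule edf_rule"
  unfolding rule_def edf_rule_def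
  by (auto intro!: winner_less profile_perm simp: valid_election_def)

text \<open>Round \<open>j\<close> uses the profiles and counts up to \<open>j\<close>; the horizon
  only determines how many winners are listed.\<close>

lemma edf_rule_online: "online edf_rule"
  unfolding online_def
proof (intro allI impI)
  fix E E' j
  assume eq: "num_voters E = num_voters E'" "num_cands E = num_cands E'"
      "voter_order E = voter_order E'" "take (Suc j) (rankings E) = take (Suc j) (rankings E')"
    and j: "j < horizon E" "j < horizon E'"
  have prof: "profile E i = profile E' i" if "i \<le> j" for i
  proof -
    have "rankings E ! i = rankings E' ! i"
      using that nth_take[of i "Suc j" "rankings E"] nth_take[of i "Suc j" "rankings E'"] eq(4) by simp
    then show ?thesis using eq(3) by (simp add: profile_def fun_eq_iff)
  qed
  have "counts n m (profile E) i = counts n m (profile E') i" if "i \<le> j" for i n m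
    using that by (induction i) (simp_all add: prof)
  then show "edf_rule E ! j = edf_rule E' ! j"
    using j prof[of j] eq by (simp add: edf_rule_def)
qed

text \<open>The group is replaced by the interval spanned by its positions. This interval is at
  least as large, and its prefix set lies inside the common top set of the group.\<close>

lemma edf_rule_droop: "satisfies_on single_crossing rank_wPSC_droop edf_rule"
  unfolding satisfies_on_def rank_wPSC_droop_def rank_wPSC_wrt_def
proof (intro allI impI)
  fix E r l S
  assume valid: "valid_election E" and sc: "single_crossing E" and r: "rank_vector E r"
    and S: "group E S" and size: "droop_size E l S" and solid: "solid E r S"
  let ?n = "num_voters E" and ?\<sigma> = "voter_order E" and ?m = "num_cands E"
  have n: "?n > 0" and m: "?m \<ge> 1" using valid by (auto simp: valid_election_def)
  have \<sigma>: "distinct ?\<sigma>" "length ?\<sigma> = ?n" "set ?\<sigma> = {..<?n}"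
    using valid unfolding valid_election_def by (auto simp: perm_distinct perm_length perm_set)
  define I where "I = {a. a < ?n \<and> ?\<sigma> ! a \<in> S}"
  have image: "S = (!) ?\<sigma> ` I"
  proof
    show "S \<subseteq> (!) ?\<sigma> ` I"
    proof
      fix i assume "i \<in> S"
      then have "i \<in> set ?\<sigma>" using S \<sigma>(3) by (auto simp: group_def)
      then obtain a where "a < ?n" "?\<sigma> ! a = i" using \<sigma>(2) by (auto simp: in_set_conv_nth)
      then show "i \<in> (!) ?\<sigma> ` I" using \<open>i \<in> S\<close> by (auto simp: I_def)
    qed
  qed (auto simp: I_def)
  have "finite I" by (simp add: I_def)
  moreover have "I \<noteq> {}" using S image by (auto simp: group_def)
  ultimately have I: "finite I" "I \<noteq> {}" .
  define a b where "a = Min I" and "b = Max I"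
  have ab: "a \<in> I" "b \<in> I" "I \<subseteq> {a..b}"
    using I by (auto simp: a_def b_def)
  then have "a \<le> b" "b < ?n" by (auto simp: I_def)
  have "card S \<le> card I" unfolding image using I(1) by (rule card_image_le)
  also have "\<dots> \<le> card {a..b}" by (rule card_mono) (use ab in auto)
  finally have card: "card S \<le> Suc b - a" by simp
  \<comment> \<open>The strict Droop bound in integers gives \<open>l * n\<close> at most
    \<open>L * (horizon + 1) - 1\<close> for the interval length \<open>L\<close>, which is
    \<open>l\<close> at most the demand at \<open>t = horizon\<close>.\<close>
  have "real (l * ?n) < real (card S * Suc (horizon E))"
    using size unfolding droop_size_def by (simp add: pos_divide_less_eq algebra_simps)
  then have "l * ?n < card S * Suc (horizon E)" by (simp only: of_nat_less_iff)
  also have "\<dots> \<le> (Suc b - a) * Suc (horizon E)" using card by (rule mult_right_mono) simp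
  finally have "l * ?n \<le> (Suc b - a) * Suc (horizon E) - 1" by linarith
  then have "l \<le> demand ?n (horizon E) (a, b)"
    using n by (simp add: demand_def less_eq_div_iff_mult_less_eq)
  also have "\<dots> \<le> counts ?n ?m (profile E) (horizon E) a b"
    by (rule demand_le_counts) fact+
  also have "\<dots> \<le> card {j. j < horizon E \<and> edf_rule E ! j \<in> (\<Union>i\<in>S. top_set E i j (r j))}"
  proof (subst counts_eq_card, rule card_mono[OF _ Collect_mono], simp, rule impI, elim conjE, rule conjI)
    fix j
    assume j: "j < horizon E"
      and w: "winner ?n ?m (profile E j) (counts ?n ?m (profile E) j) \<in> common_top (profile E j) a b"
    have rj: "1 \<le> r j" "r j \<le> ?m" using r j by (auto simp: rank_vector_def)
    have less: "a < ?n" "b < ?n" using ab by (auto simp: I_def)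
    have mem: "?\<sigma> ! a \<in> S" "?\<sigma> ! b \<in> S" using ab by (auto simp: I_def)
    let ?X = "\<Inter>i\<in>S. top_set E i j (r j)"
    \<comment> \<open>The intersection and each top set of a member have size \<open>r j\<close>, so
      they coincide. Hence \<open>r j\<close> is a rank at which the two endpoints agree.\<close>
    have X: "?X = set (take (r j) (profile E j c))" if "c < ?n" "?\<sigma> ! c \<in> S" for c
    proof (rule card_subset_eq)
      show "?X \<subseteq> set (take (r j) (profile E j c))"
        using that by (auto simp: top_set_def profile_def)
      have "card (set (take (r j) (profile E j c))) = r j"
        using profile_perm[OF valid j that(1)] rj
        by (simp add: card_set_take perm_distinct perm_length)
      then show "card ?X = card (set (take (r j) (profile E j c)))"
        using solid j by (simp add: solid_def)
    qed simp
    have "common_rank (profile E j a) (profile E j b) \<le> r j"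
      using rj(1) X[OF less(1) mem(1)] X[OF less(2) mem(2)]
      by (intro common_rank_le[OF m profile_perm[OF valid j less(1)] profile_perm[OF valid j less(2)]]) auto
    then have "common_top (profile E j) a b \<subseteq> top_set E (?\<sigma> ! a) j (r j)"
      unfolding common_top_def top_set_def profile_def by (rule set_take_subset_set_take)
    then show "edf_rule E ! j \<in> (\<Union>i\<in>S. top_set E i j (r j))"
      using w mem(1) j by (auto simp: edf_rule_def)
  qed
  finally show "l \<le> card {j. j < horizon E \<and> edf_rule E ! j \<in> (\<Union>i\<in>S. top_set E i j (r j))}" .
qed

text \<open>Since \<open>l\<close> and the number of voters are positive, the larger denominator
  makes the Droop threshold strictly smaller.\<close>

lemma hare_size_imp_droop_size:
  assumes "valid_election E" "l \<ge> 1" "hare_size E l S"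
  shows "droop_size E l S"
proof -
  have "real l * real (num_voters E) > 0" "real (horizon E) > 0"
    using assms by (auto simp: valid_election_def)
  then have "real l * real (num_voters E) / (real (horizon E) + 1) < real l * real (num_voters E) / real (horizon E)"
    by (intro divide_strict_left_mono) auto
  then show ?thesis using assms(3) unfolding hare_size_def droop_size_def by linarith
qed

lemma edf_rule_hare: "satisfies_on single_crossing rank_wPSC edf_rule"
  using edf_rule_droop hare_size_imp_droop_size
  unfolding satisfies_on_def rank_wPSC_def rank_wPSC_droop_def rank_wPSC_wrt_def by blast

section \<open>Loop programs\<close>

text \<open>The loop \<open>PFor i k c\<close> runs \<open>i\<close> up to the value of the input cell \<open>k\<close>. In a well-formed program \<open>k\<close> is
  one of the three cells holding the numbers of voters, candidates and rounds, and the input is never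
  overwritten; this is why programs have a total semantics \<open>sem\<close> and a polynomial cost.\<close>

datatype prog =
    PWrite nat expr expr
  | PSeq prog prog (infixr ";;" 60)
  | PIf expr prog prog
  | PFor nat nat prog

primrec compile :: "prog \<Rightarrow> com" where
  "compile (PWrite a e e') = Write a e e'"
| "compile (c ;; d) = Seq (compile c) (compile d)"
| "compile (PIf e c d) = com.If e (compile c) (compile d)"
| "compile (PFor i k c) = Seq (Write i (Const 0) (Const 0))
     (While (Monus (Read 0 (Const k)) (Read i (Const 0)))
       (Seq (compile c) (Write i (Const 0) (Plus (Read i (Const 0)) (Const 1)))))"

definition put :: "nat \<Rightarrow> nat \<Rightarrow> nat \<Rightarrow> store \<Rightarrow> store" where
  "put a x v s = s(a := (s a)(x := v))"

primrec sem :: "prog \<Rightarrow> store \<Rightarrow> store" where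
  "sem (PWrite a e e') s = put a (val e s) (val e' s) s"
| "sem (c ;; d) s = sem d (sem c s)"
| "sem (PIf e c d) s = (if val e s \<noteq> 0 then sem c s else sem d s)"
| "sem (PFor i k c) s = ((\<lambda>\<sigma>. put i 0 (Suc (sem c \<sigma> i 0)) (sem c \<sigma>)) ^^ s 0 k) (put i 0 0 s)"

primrec writes :: "prog \<Rightarrow> nat set" where
  "writes (PWrite a e e') = {a}"
| "writes (c ;; d) = writes c \<union> writes d"
| "writes (PIf e c d) = writes c \<union> writes d"
| "writes (PFor i k c) = insert i (writes c)"

primrec well_formed :: "prog \<Rightarrow> bool" where
  "well_formed (PWrite a e e') \<longleftrightarrow> a \<noteq> 0"
| "well_formed (c ;; d) \<longleftrightarrow> well_formed c \<and> well_formed d"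
| "well_formed (PIf e c d) \<longleftrightarrow> well_formed c \<and> well_formed d"
| "well_formed (PFor i k c) \<longleftrightarrow> i \<noteq> 0 \<and> k < 3 \<and> i \<notin> writes c \<and> well_formed c"

text \<open>A polynomial in a bound on the three size cells. A branch is charged for both
  alternatives. An iteration pays for body, increment and test; the extra 2 pays for initialising
  the counter and for the last test.\<close>

primrec cost :: "prog \<Rightarrow> nat poly" where
  "cost (PWrite a e e') = 1"
| "cost (c ;; d) = cost c + cost d"
| "cost (PIf e c d) = cost c + cost d + 1"
| "cost (PFor i k c) = 2 + [:0, 1:] * (cost c + 2)"

lemma put_same [simp]: "put a x v s a = (s a)(x := v)"
  and put_other [simp]: "b \<noteq> a \<Longrightarrow> put a x v s b = s b"
  by (simp_all add: put_def)

lemma exec_put: "exec (Write a e e') s 1 (put a (val e s) (val e' s) s)"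
  unfolding put_def by (rule exec.Write)

lemma well_formed_writes: "well_formed c \<Longrightarrow> 0 \<notin> writes c"
  by (induction c) auto

lemma sem_frame: "a \<notin> writes c \<Longrightarrow> sem c s a = s a"
proof (induction c arbitrary: s)
  case (PFor i k c)
  have "((\<lambda>\<sigma>. put i 0 (Suc (sem c \<sigma> i 0)) (sem c \<sigma>)) ^^ j) \<sigma> a = \<sigma> a" for j \<sigma>
    using PFor by (induction j) auto
  then show ?case using PFor by simp
qed auto

declare sem.simps(4) [simp del]

text \<open>A Hoare rule for counted loops. It supplies the counter value and the unchanged arrays
  in each step, so \<open>I\<close> need only describe what the body changes.\<close>

lemma sem_For:
  assumes i: "i \<notin> writes c"
    and init: "I 0 (put i 0 0 s)"
    and step: "\<And>j \<sigma>. j < s 0 k \<Longrightarrow> (\<And>a. a \<notin> insert i (writes c) \<Longrightarrow> \<sigma> a = s a) \<Longrightarrow>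
      \<sigma> i 0 = j \<Longrightarrow> I j \<sigma> \<Longrightarrow> I (Suc j) (put i 0 (Suc j) (sem c \<sigma>))"
  shows "I (s 0 k) (sem (PFor i k c) s)"
proof -
  let ?f = "\<lambda>\<sigma>. put i 0 (Suc (sem c \<sigma> i 0)) (sem c \<sigma>)"
  have "I j \<sigma> \<and> \<sigma> i 0 = j \<and> (\<forall>a. a \<notin> insert i (writes c) \<longrightarrow> \<sigma> a = s a)"
    if "j \<le> s 0 k" "\<sigma> = (?f ^^ j) (put i 0 0 s)" for j \<sigma>
    using that
  proof (induction j arbitrary: \<sigma>)
    case 0
    then show ?case using init by simp
  next
    case (Suc j)
    let ?\<tau> = "(?f ^^ j) (put i 0 0 s)"
    from Suc.IH[OF _ refl] Suc.prems have \<tau>: "I j ?\<tau>" "?\<tau> i 0 = j" "\<forall>a. a \<notin> insert i (writes c) \<longrightarrow> ?\<tau> a = s a"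
      by simp_all
    then have "\<sigma> = put i 0 (Suc j) (sem c ?\<tau>)"
      using Suc.prems(2) sem_frame[OF i, of ?\<tau>] by simp
    then show ?case
      using step[of j ?\<tau>] Suc.prems(1) \<tau> sem_frame[of _ c ?\<tau>] by simp
  qed
  from this[OF order.refl refl] show ?thesis by (simp add: sem.simps(4))
qed

text \<open>The body changes neither the input nor the loop counter, so the compiled while loop runs
  exactly as often as the iterated semantics says.\<close>

lemma exec_compile:
  assumes "well_formed c" "\<And>k. k < 3 \<Longrightarrow> s 0 k \<le> N"
  shows "\<exists>t \<le> poly (cost c) N. exec (compile c) s t (sem c s)"
  using assms
proof (induction c arbitrary: s)
  case (PWrite a e e')
  then show ?case using exec_put[of a e e' s] by auto
next
  case (PSeq c d)
  have "sem c s 0 = s 0" using PSeq.prems(1) by (intro sem_frame well_formed_writes) simp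
  then have N: "\<And>k. k < 3 \<Longrightarrow> sem c s 0 k \<le> N" using PSeq.prems(2) by simp
  from PSeq.IH(1)[of s] PSeq.prems obtain t
    where t: "t \<le> poly (cost c) N" "exec (compile c) s t (sem c s)" by auto
  from PSeq.IH(2)[of "sem c s"] N PSeq.prems(1) obtain t'
    where t': "t' \<le> poly (cost d) N" "exec (compile d) (sem c s) t' (sem d (sem c s))" by auto
  show ?case
    using exec.Seq[OF t(2) t'(2)] t(1) t'(1) by (auto intro!: exI[of _ "t + t'"])
next
  case (PIf e c d)
  show ?case
  proof (cases "val e s = 0")
    case True
    from PIf.IH(2)[of s] PIf.prems obtain t
      where "t \<le> poly (cost d) N" "exec (compile d) s t (sem d s)" by auto
    then show ?thesis using exec.IfFalse[of e s "compile d" t _ "compile c"] True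
      by (auto intro!: exI[of _ "t + 1"])
  next
    case False
    from PIf.IH(1)[of s] PIf.prems obtain t
      where "t \<le> poly (cost c) N" "exec (compile c) s t (sem c s)" by auto
    then show ?thesis using exec.IfTrue[of e s "compile c" t _ "compile d"] False
      by (auto intro!: exI[of _ "t + 1"])
  qed
next
  case (PFor i k c)
  let ?f = "\<lambda>\<sigma>. put i 0 (Suc (sem c \<sigma> i 0)) (sem c \<sigma>)"
  let ?e = "Monus (Read 0 (Const k)) (Read i (Const 0))"
  let ?b = "Seq (compile c) (Write i (Const 0) (Plus (Read i (Const 0)) (Const 1)))"
  let ?K = "poly (cost c) N + 2"
  have wf: "i \<noteq> 0" "k < 3" "i \<notin> writes c" "well_formed c" using PFor.prems by auto
  \<comment> \<open>Induction on the number \<open>d\<close> of iterations still to come, starting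
    from an arbitrary counter value.\<close>
  have loop: "\<exists>t \<le> d * ?K + 1. exec (While ?e ?b) \<sigma> t ((?f ^^ d) \<sigma>)"
    if "\<sigma> 0 = s 0" "\<sigma> i 0 + d = s 0 k" for d \<sigma>
    using that
  proof (induction d arbitrary: \<sigma>)
    case 0
    then show ?case using exec.WhileFalse[of ?e \<sigma> ?b] by auto
  next
    case (Suc d)
    have "?f \<sigma> 0 = s 0" "?f \<sigma> i 0 + d = s 0 k"
      using Suc.prems wf sem_frame[of _ c \<sigma>] well_formed_writes[OF wf(4)] by auto
    from Suc.IH[OF this] obtain t'
      where t': "t' \<le> d * ?K + 1" "exec (While ?e ?b) (?f \<sigma>) t' ((?f ^^ d) (?f \<sigma>))" by blast
    from PFor.IH[OF wf(4), of \<sigma>] Suc.prems PFor.prems obtain t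
      where t: "t \<le> poly (cost c) N" "exec (compile c) \<sigma> t (sem c \<sigma>)" by auto
    have "exec ?b \<sigma> (t + 1) (?f \<sigma>)"
      using exec.Seq[OF t(2) exec_put[of i "Const 0" "Plus (Read i (Const 0)) (Const 1)"]] by simp
    moreover have "val ?e \<sigma> \<noteq> 0" using Suc.prems by simp
    ultimately have "exec (While ?e ?b) \<sigma> (t + 1 + t' + 1) ((?f ^^ d) (?f \<sigma>))"
      using exec.WhileTrue t'(2) by blast
    moreover have "t + 1 + t' + 1 \<le> Suc d * ?K + 1" using t(1) t'(1) by simp
    ultimately show ?case unfolding funpow_Suc_right comp_def by blast
  qed
  obtain t where t: "t \<le> s 0 k * ?K + 1"
    "exec (While ?e ?b) (put i 0 0 s) t ((?f ^^ s 0 k) (put i 0 0 s))"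
    using loop[of "put i 0 0 s" "s 0 k"] wf by auto
  have "exec (compile (PFor i k c)) s (1 + t) (sem (PFor i k c) s)"
    using exec.Seq[OF exec_put[of i "Const 0" "Const 0" s], of "While ?e ?b" t] t(2) by (simp add: sem.simps(4))
  moreover have "s 0 k * ?K \<le> N * ?K" using PFor.prems(2)[OF wf(2)] by (rule mult_right_mono) simp
  then have "1 + t \<le> poly (cost (PFor i k c)) N" using t(1) by (simp add: numeral_poly)
  ultimately show ?case by blast
qed

section \<open>The program\<close>

text \<open>Arrays 2 to 20 are used as scalars. At position \<open>a\<close> of the voter order, \<open>OFF\<close> holds the input
  address of the ranking of that voter in the current round, whose block of rankings starts at \<open>base\<close>;
  \<open>PT\<close> holds the inverse of that ranking at the same address. \<open>RR\<close> and \<open>CNT\<close> are n by n tables of the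
  common ranks and of the counts. Array 25 is a dummy for \<open>skip\<close>.\<close>

abbreviation (input) "jv \<equiv> 2::nat"
abbreviation (input) "av \<equiv> 3::nat"
abbreviation (input) "bv \<equiv> 4::nat"
abbreviation (input) "kv \<equiv> 5::nat"
abbreviation (input) "iv \<equiv> 6::nat"
abbreviation (input) "itv \<equiv> 7::nat"
abbreviation (input) "base \<equiv> 8::nat"
abbreviation (input) "row \<equiv> 9::nat"
abbreviation (input) "yav \<equiv> 10::nat"
abbreviation (input) "yrv \<equiv> 11::nat"
abbreviation (input) "bsv \<equiv> 12::nat"
abbreviation (input) "blv \<equiv> 13::nat"
abbreviation (input) "bav \<equiv> 14::nat"
abbreviation (input) "brv \<equiv> 15::nat"
abbreviation (input) "qv \<equiv> 16::nat"
abbreviation (input) "okv \<equiv> 17::nat"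
abbreviation (input) "p1v \<equiv> 18::nat"
abbreviation (input) "p2v \<equiv> 19::nat"
abbreviation (input) "wv \<equiv> 20::nat"
abbreviation (input) "OFF \<equiv> 21::nat"
abbreviation (input) "PT \<equiv> 22::nat"
abbreviation (input) "RR \<equiv> 23::nat"
abbreviation (input) "CNT \<equiv> 24::nat"

definition var :: "nat \<Rightarrow> expr" where "var x = Read x (Const 0)"
definition assign :: "nat \<Rightarrow> expr \<Rightarrow> prog" where "assign x e = PWrite x (Const 0) e"
definition skip :: prog where "skip = PWrite 25 (Const 0) (Read 25 (Const 0))"
definition inp :: "expr \<Rightarrow> expr" where "inp e = Read 0 e"

text \<open>The entry of an n by n table for the current pair; \<open>row\<close> holds n times the first component.\<close>

definition cell :: expr where "cell = Plus (var row) (var bv)"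

definition for_pairs :: "prog \<Rightarrow> prog" where
  "for_pairs c = assign row (Const 0) ;;
     PFor av 0 (PFor bv 0 c ;; assign row (Plus (var row) (inp (Const 0))))"

text \<open>Repeated addition. The loop runs \<open>n\<close> times, so the product is correct for
  second factors up to \<open>n\<close>.\<close>

definition mult_prog :: "nat \<Rightarrow> expr \<Rightarrow> expr \<Rightarrow> prog" where
  "mult_prog z e e' = assign z (Const 0) ;;
     PFor iv 0 (PIf (Monus e' (var iv)) (assign z (Plus (var z) e)) skip)"

text \<open>The ranking of voter \<open>v\<close> starts at \<open>base + m * v\<close>; the product
  is built by \<open>m\<close> additions.\<close>

definition offsets_prog :: prog where
  "offsets_prog = PFor av 0 (PWrite OFF (var av) (var base) ;;
     PFor iv 1 (PWrite OFF (var av) (Plus (Read OFF (var av)) (inp (Plus (Const 3) (var av))))))"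

definition cand :: expr where "cand = inp (Plus (Read OFF (var av)) (var kv))"

definition positions_prog :: prog where
  "positions_prog = PFor av 0 (PFor kv 1 (PWrite PT (Plus (Read OFF (var av)) cand) (var kv)))"

text \<open>A closure computation: whenever one of the top \<open>r\<close> of the first voter lies
  beyond \<open>r\<close> for the second, \<open>r\<close> is raised to include it. One pass
  suffices, because nothing changes any more once \<open>k\<close> has reached
  \<open>r\<close>.\<close>

definition rank_prog :: prog where
  "rank_prog = PWrite RR cell (Const 1) ;;
     PFor kv 1
       (assign qv (Read PT (Plus (Read OFF (var bv)) cand)) ;;
        PIf (Monus (Read RR cell) (var kv))
          (PIf (Monus (Plus (var qv) (Const 1)) (Read RR cell))
             (PWrite RR cell (Plus (var qv) (Const 1))) skip) skip)"

text \<open>The two sets have as many elements as their ranks, so inclusion is proper exactly if the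
  ranks differ strictly; the initial truncated difference tests this.\<close>

definition subset_prog :: prog where
  "subset_prog = assign okv (Monus (var yrv) (Read RR cell)) ;;
     PFor kv 1
       (PIf (Monus (Read RR cell) (var kv))
         (PIf (Monus (Plus (Read PT (Plus (Read OFF (var yav)) cand)) (Const 1)) (var yrv))
           (assign okv (Const 0)) skip) skip)"

definition improve_prog :: prog where
  "improve_prog = subset_prog ;;
     mult_prog p1v (Plus (Read CNT cell) (Const 1)) (var blv) ;;
     mult_prog p2v (var bsv) (Monus (Plus (var bv) (Const 1)) (var av)) ;;
     PIf (var okv) (PIf (Monus (var p2v) (var p1v))
       (assign bsv (Plus (Read CNT cell) (Const 1)) ;;
        assign blv (Monus (Plus (var bv) (Const 1)) (var av)) ;;
        assign bav (var av) ;; assign brv (Read RR cell)) skip) skip"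

definition shrink_prog :: prog where
  "shrink_prog = assign bsv (Const 1) ;; assign blv (Const 0) ;; assign bav (Const 0) ;;
     assign brv (Const 0) ;; for_pairs improve_prog ;;
     PIf (var blv) (assign yav (var bav) ;; assign yrv (var brv)) skip"

definition winner_prog :: prog where
  "winner_prog = assign yav (Const 0) ;; assign yrv (inp (Const 1)) ;; PFor itv 1 shrink_prog ;;
     assign wv (inp (Read OFF (var yav)))"

text \<open>The winner lies in the prefix set of the pair exactly if its position in the first
  voter's ranking is below the common rank.\<close>

definition update_prog :: prog where
  "update_prog = for_pairs (PIf (Monus (Read RR cell) (Read PT (Plus (Read OFF (var av)) (var wv))))
     (PWrite CNT cell (Plus (Read CNT cell) (Const 1))) skip)"

definition round_prog :: prog where
  "round_prog = offsets_prog ;; positions_prog ;; for_pairs rank_prog ;; winner_prog ;;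
     PWrite 1 (var jv) (var wv) ;; update_prog ;;
     PFor av 0 (assign base (Plus (var base) (inp (Const 1))))"

definition main_prog :: prog where
  "main_prog = assign base (Plus (Const 3) (inp (Const 0))) ;; PFor jv 2 round_prog"

lemmas prog_defs = for_pairs_def mult_prog_def offsets_prog_def positions_prog_def rank_prog_def
  subset_prog_def improve_prog_def shrink_prog_def winner_prog_def update_prog_def round_prog_def
  main_prog_def

section \<open>Rules for reasoning about the program pieces\<close>

lemma val_simps [simp]: "val (var x) s = s x 0" "val (inp e) s = s 0 (val e s)"
  "val cell s = s row 0 + s bv 0" "val cand s = s 0 (s OFF (s av 0) + s kv 0)"
  by (simp_all add: var_def inp_def cell_def cand_def)

lemma sem_skip [simp]: "sem skip s = s"
  by (simp add: skip_def put_def)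

lemma sem_assign [simp]: "sem (assign x e) s = put x 0 (val e s) s"
  by (simp add: assign_def)

lemma writes_simps [simp]: "writes skip = {25}" "writes (assign x e) = {x}"
  "well_formed skip" "well_formed (assign x e) \<longleftrightarrow> x \<noteq> 0"
  by (simp_all add: skip_def assign_def)

lemma well_formed_main: "well_formed main_prog"
  by (simp add: prog_defs)

text \<open>The first two assumptions say that the factors do not depend on what the loop
  overwrites. The partial product carries a minimum, since later iterations add nothing.\<close>

lemma sem_mult:
  assumes e: "\<And>\<sigma>. (\<And>a. a \<notin> {25, z, iv} \<Longrightarrow> \<sigma> a = s a) \<Longrightarrow> val e \<sigma> = val e s"
    and e': "\<And>\<sigma>. (\<And>a. a \<notin> {25, z, iv} \<Longrightarrow> \<sigma> a = s a) \<Longrightarrow> val e' \<sigma> = val e' s"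
    and z: "z \<notin> {0, 25, iv}" and le: "val e' s \<le> s 0 0"
  shows "sem (mult_prog z e e') s z 0 = val e s * val e' s"
proof -
  let ?s = "put z 0 0 s"
  have "sem (mult_prog z e e') s z 0 = val e s * min (?s 0 0) (val e' s)"
    unfolding mult_prog_def sem.simps(2) sem_assign val.simps
  proof (rule sem_For[where I = "\<lambda>j \<sigma>. \<sigma> z 0 = val e s * min j (val e' s)"])
    fix j \<sigma>
    assume *: "\<And>a. a \<notin> insert iv (writes (PIf (Monus e' (var iv)) (assign z (Plus (var z) e)) skip)) \<Longrightarrow>
        \<sigma> a = ?s a" "\<sigma> iv 0 = j" "\<sigma> z 0 = val e s * min j (val e' s)"
    then have "\<sigma> a = s a" if "a \<notin> {25, z, iv}" for a using that by simp
    then have "val e \<sigma> = val e s" "val e' \<sigma> = val e' s" using e e' by blast+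
    then show "put iv 0 (Suc j) (sem (PIf (Monus e' (var iv)) (assign z (Plus (var z) e)) skip) \<sigma>) z 0
        = val e s * min (Suc j) (val e' s)"
      using * z by (auto simp: min_def not_le)
  qed (use z in auto)
  also have "min (?s 0 0) (val e' s) = val e' s" using le z by simp
  finally show ?thesis .
qed

lemma pair_index_eq:
  fixes a b n :: nat
  assumes "b < n" "b' < n" "a * n + b = a' * n + b'"
  shows "a = a' \<and> b = b'"
proof -
  have "(a * n + b) div n = a" "(a' * n + b') div n = a'" using assms(1,2) by simp_all
  moreover have "(a * n + b) mod n = b" "(a' * n + b') mod n = b'" using assms(1,2) by simp_all
  ultimately show ?thesis using assms(3) by metis
qed

lemma product_upt_Suc:
  "List.product [0..<Suc a] ys = List.product [0..<a] ys @ map (Pair a) ys"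
proof -
  have "List.product (xs @ zs) ys = List.product xs ys @ List.product zs ys" for xs zs :: "nat list"
    by (induction xs) auto
  then show ?thesis by simp
qed

text \<open>A Hoare rule for the double loop. The invariant is indexed by the list of pairs already
  visited, in the same order as the fold in \<open>shrink\<close>, and must ignore the loop
  registers.\<close>

lemma sem_for_pairs:
  fixes s :: store
  defines "n \<equiv> s 0 0"
  assumes wr: "writes c \<inter> {0, row, av, bv} = {}"
    and cong: "\<And>xs \<sigma> \<sigma>'. (\<And>x. x \<notin> {row, av, bv} \<Longrightarrow> \<sigma>' x = \<sigma> x) \<Longrightarrow> I xs \<sigma> \<Longrightarrow> I xs \<sigma>'"
    and init: "I [] s"
    and step: "\<And>xs a b \<sigma>. a < n \<Longrightarrow> b < n \<Longrightarrow> set xs \<subseteq> {..<n} \<times> {..<n} \<Longrightarrow> (a, b) \<notin> set xs \<Longrightarrow>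
      (\<And>x. x \<notin> {row, av, bv} \<union> writes c \<Longrightarrow> \<sigma> x = s x) \<Longrightarrow>
      \<sigma> row 0 = a * n \<Longrightarrow> \<sigma> av 0 = a \<Longrightarrow> \<sigma> bv 0 = b \<Longrightarrow> I xs \<sigma> \<Longrightarrow> I (xs @ [(a, b)]) (sem c \<sigma>)"
  shows "I (List.product [0..<n] [0..<n]) (sem (for_pairs c) s)"
proof -
  let ?s = "put row 0 0 s"
  let ?inner = "PFor bv 0 c ;; assign row (Plus (var row) (inp (Const 0)))"
  let ?J = "\<lambda>a \<sigma>. I (List.product [0..<a] [0..<n]) \<sigma> \<and> \<sigma> row 0 = a * n"
  have "?J (?s 0 0) (sem (PFor av 0 ?inner) ?s)"
  proof (rule sem_For[where I = ?J])
    show "?J 0 (put av 0 0 ?s)"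
      using cong[OF _ init, of "put av 0 0 ?s"] by simp
    fix a \<sigma>
    assume a: "a < ?s 0 0" and fr: "\<And>x. x \<notin> insert av (writes ?inner) \<Longrightarrow> \<sigma> x = ?s x"
      and av: "\<sigma> av 0 = a" and J: "?J a \<sigma>"
    have n: "\<sigma> 0 0 = n" using fr[of 0] wr by (auto simp: n_def)
    let ?K = "\<lambda>b \<tau>. I (List.product [0..<a] [0..<n] @ map (Pair a) [0..<b]) \<tau>"
    have "?K (\<sigma> 0 0) (sem (PFor bv 0 c) \<sigma>)"
    proof (rule sem_For[where I = ?K])
      show "bv \<notin> writes c" using wr by auto
      show "?K 0 (put bv 0 0 \<sigma>)" using J cong[of "put bv 0 0 \<sigma>" \<sigma>] by simp
      fix b \<tau>
      assume b: "b < \<sigma> 0 0" and fr': "\<And>x. x \<notin> insert bv (writes c) \<Longrightarrow> \<tau> x = \<sigma> x"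
        and bv: "\<tau> bv 0 = b" and K: "?K b \<tau>"
      have "I ((List.product [0..<a] [0..<n] @ map (Pair a) [0..<b]) @ [(a, b)]) (sem c \<tau>)"
      proof (rule step[OF _ _ _ _ _ _ _ bv K])
        show "\<tau> x = s x" if "x \<notin> {row, av, bv} \<union> writes c" for x
          using that fr[of x] fr'[of x] by simp
        show "\<tau> row 0 = a * n" "\<tau> av 0 = a" using fr'[of row] fr'[of av] J av wr by auto
      qed (use a b n in \<open>auto simp: n_def\<close>)
      then show "?K (Suc b) (put bv 0 (Suc b) (sem c \<tau>))"
        using cong[of "put bv 0 (Suc b) (sem c \<tau>)" "sem c \<tau>"] by simp
    qed
    then have I: "I (List.product [0..<Suc a] [0..<n]) (sem (PFor bv 0 c) \<sigma>)"
      by (simp only: n product_upt_Suc)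
    have "sem (PFor bv 0 c) \<sigma> row 0 = a * n" "sem (PFor bv 0 c) \<sigma> 0 0 = n"
      using sem_frame[of row "PFor bv 0 c" \<sigma>] sem_frame[of 0 "PFor bv 0 c" \<sigma>] wr J n by auto
    then show "?J (Suc a) (put av 0 (Suc a) (sem ?inner \<sigma>))"
      using cong[OF _ I, of "put av 0 (Suc a) (sem ?inner \<sigma>)"] by simp
  qed (use wr in auto)
  then show ?thesis by (simp add: for_pairs_def n_def)
qed

section \<open>Correctness of one round of the program\<close>

lemma writes_shrink_prog:
  "writes shrink_prog =
     {row, av, bv, 25, kv, okv, iv, p1v, p2v, bsv, blv, bav, brv, yav, yrv}"
  by (auto simp: shrink_prog_def for_pairs_def improve_prog_def subset_prog_def mult_prog_def)

text \<open>One round as seen by the program: the ranking at position \<open>a\<close> is stored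
  from address \<open>off a\<close> on. By \<open>off_inj\<close> these blocks do not overlap, so a
  single array can hold all inverse rankings.\<close>

locale single_round =
  fixes A :: "nat \<Rightarrow> nat" and n m :: nat and off :: "nat \<Rightarrow> nat" and P :: "nat \<Rightarrow> nat list"
  assumes A: "A 0 = n" "A 1 = m" and n: "n > 0" and m: "m \<ge> 1"
    and perm: "\<And>a. a < n \<Longrightarrow> P a \<in> permutations_of_set {..<m}"
    and A_off: "\<And>a k. a < n \<Longrightarrow> k < m \<Longrightarrow> A (off a + k) = P a ! k"
    and off_inj: "\<And>a b c d. a < n \<Longrightarrow> b < n \<Longrightarrow> c < m \<Longrightarrow> d < m \<Longrightarrow> off a + c = off b + d \<Longrightarrow> a = b"
begin

definition tables :: "store \<Rightarrow> bool" where
  "tables s \<longleftrightarrow> s 0 = A \<and> (\<forall>a<n. s OFF a = off a) \<and> (\<forall>a<n. \<forall>k<m. s PT (off a + P a ! k) = k)"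

lemma tables_cong: "tables s \<Longrightarrow> s' 0 = s 0 \<Longrightarrow> s' OFF = s OFF \<Longrightarrow> s' PT = s PT \<Longrightarrow> tables s'"
  by (simp add: tables_def)

lemma P_less: "a < n \<Longrightarrow> k < m \<Longrightarrow> P a ! k < m"
  using perm perm_nth_less by blast

lemma P_in_take_iff: "a < n \<Longrightarrow> k < m \<Longrightarrow> P a ! k \<in> set (take r (P a)) \<longleftrightarrow> k < r"
  by (simp add: nth_in_take_iff perm_distinct[OF perm] perm_length[OF perm])

lemma set_take_P: "a < n \<Longrightarrow> r \<le> m \<Longrightarrow> set (take r (P a)) = (\<lambda>k. P a ! k) ` {..<r}"
  by (simp add: perm_length[OF perm] nth_image lessThan_atLeast0)

lemma card_set_take_P: "a < n \<Longrightarrow> r \<le> m \<Longrightarrow> card (set (take r (P a))) = r"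
  by (simp add: card_set_take perm_distinct[OF perm] perm_length[OF perm])

lemma tables_less_iff:
  assumes "tables s" "a < n" "c < m"
  shows "s PT (off a + c) < r \<longleftrightarrow> c \<in> set (take r (P a))"
proof -
  obtain k where k: "k < m" "P a ! k = c"
    using perm_set[OF perm] perm_length[OF perm] assms(2,3) by (metis in_set_conv_nth lessThan_iff)
  then show ?thesis
    using assms P_in_take_iff by (auto simp: tables_def)
qed

section \<open>The tables of positions and common ranks\<close>

lemma sem_positions:
  assumes s: "s 0 = A" "\<And>a. a < n \<Longrightarrow> s OFF a = off a"
  shows "tables (sem positions_prog s)"
proof -
  let ?c = "PWrite PT (Plus (Read OFF (var av)) cand) (var kv)"
  let ?I = "\<lambda>a \<sigma>. \<forall>a'<a. \<forall>k<m. (\<sigma> :: store) PT (off a' + P a' ! k) = k"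
  have s0: "s 0 0 = n" "s 0 1 = m" using s A by auto
  have "?I (s 0 0) (sem (PFor av 0 (PFor kv 1 ?c)) s)"
  proof (rule sem_For[where I = ?I])
    fix a \<sigma>
    assume a: "a < s 0 0" and fr: "\<And>x. x \<notin> insert av (writes (PFor kv 1 ?c)) \<Longrightarrow> \<sigma> x = s x"
      and av: "\<sigma> av 0 = a" and I: "?I a \<sigma>"
    have \<sigma>: "\<sigma> 0 = A" "\<sigma> OFF = s OFF" using fr[of 0] fr[of OFF] s by auto
    let ?K = "\<lambda>k \<tau>. ?I a \<tau> \<and> (\<forall>k'<k. (\<tau> :: store) PT (off a + P a ! k') = k')"
    have "?K (\<sigma> 0 1) (sem (PFor kv 1 ?c) \<sigma>)"
    proof (rule sem_For[where I = ?K])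
      show "?K 0 (put kv 0 0 \<sigma>)" using I by simp
      fix k \<tau>
      assume k: "k < \<sigma> 0 1" and fr': "\<And>x. x \<notin> insert kv (writes ?c) \<Longrightarrow> \<tau> x = \<sigma> x"
        and kv: "\<tau> kv 0 = k" and K: "?K k \<tau>"
      have km: "k < m" using k \<sigma> A by simp
      have an: "a < n" using a s0 by simp
      have "\<tau> OFF a = off a" "\<tau> 0 = A" "\<tau> av 0 = a"
        using fr'[of OFF] fr'[of 0] fr'[of av] \<sigma> s(2)[OF an] av by auto
      then have "sem ?c \<tau> = put PT (off a + P a ! k) k \<tau>"
        using kv A_off[OF an km] by simp
      moreover have "off a' + P a' ! k' \<noteq> off a + P a ! k" if "a' < a" "k' < m" for a' k'
        using off_inj[of a' a "P a' ! k'" "P a ! k"] that an km P_less by auto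
      moreover have "P a ! k' \<noteq> P a ! k" if "k' < k" for k'
        using that km perm[OF an] by (simp add: nth_eq_iff_index_eq perm_distinct perm_length)
      ultimately show "?K (Suc k) (put kv 0 (Suc k) (sem ?c \<tau>))"
        using K by (auto simp: less_Suc_eq)
    qed simp
    then show "?I (Suc a) (put av 0 (Suc a) (sem (PFor kv 1 ?c) \<sigma>))"
      using \<sigma> A by (simp add: less_Suc_eq)
  qed auto
  then show ?thesis
    using s s0 sem_frame[of _ "PFor av 0 (PFor kv 1 ?c)" s]
    by (simp add: tables_def positions_prog_def)
qed

text \<open>During the scan the entry stays at most the common rank. At the end the prefixes of that
  size agree, so minimality of the common rank gives equality.\<close>

lemma sem_rank:
  assumes \<sigma>: "tables \<sigma>" and ab: "\<sigma> av 0 = a" "\<sigma> bv 0 = b" "a < n" "b < n"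
  defines "i \<equiv> \<sigma> row 0 + b"
  shows "sem rank_prog \<sigma> RR i = common_rank (P a) (P b)"
    and "x \<noteq> i \<Longrightarrow> sem rank_prog \<sigma> RR x = \<sigma> RR x"
proof -
  let ?c = "assign qv (Read PT (Plus (Read OFF (var bv)) cand)) ;;
        PIf (Monus (Read RR cell) (var kv))
          (PIf (Monus (Plus (var qv) (Const 1)) (Read RR cell))
             (PWrite RR cell (Plus (var qv) (Const 1))) skip) skip"
  let ?s = "put RR i 1 \<sigma>" and ?R = "common_rank (P a) (P b)"
  let ?I = "\<lambda>k (\<tau> :: store). (\<forall>x. x \<noteq> i \<longrightarrow> \<tau> RR x = \<sigma> RR x) \<and> 1 \<le> \<tau> RR i \<and> \<tau> RR i \<le> ?R \<and>
    (\<forall>k'<k. k' < \<tau> RR i \<longrightarrow> P a ! k' \<in> set (take (\<tau> RR i) (P b)))"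
  note R = common_rank_props[OF m perm perm, OF ab(3,4)]
  have s0: "?s 0 1 = m" using \<sigma> A by (simp add: tables_def)
  have inv: "?I (?s 0 1) (sem (PFor kv 1 ?c) ?s)"
  proof (rule sem_For[where I = ?I])
    show "?I 0 (put kv 0 0 ?s)" using R by simp
    fix k \<tau>
    assume k: "k < ?s 0 1" and fr: "\<And>x. x \<notin> insert kv (writes ?c) \<Longrightarrow> \<tau> x = ?s x"
      and kv: "\<tau> kv 0 = k" and I: "?I k \<tau>"
    have km: "k < m" using k s0 by simp
    have \<tau>: "tables \<tau>" using fr by (intro tables_cong[OF \<sigma>]) auto
    have regs: "\<tau> av 0 = a" "\<tau> bv 0 = b" "\<tau> row 0 + b = i"
      using fr[of av] fr[of bv] fr[of row] ab by (auto simp: i_def)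
    have offs: "\<tau> OFF b = off b" "\<tau> 0 (\<tau> OFF a + k) = P a ! k"
      using \<tau> ab A_off[OF ab(3) km] by (auto simp: tables_def)
    define q where "q = \<tau> PT (off b + P a ! k)"
    define g where "g = \<tau> RR i"
    have q: "q < r \<longleftrightarrow> P a ! k \<in> set (take r (P b))" for r
      unfolding q_def using tables_less_iff[OF \<tau> ab(4)] P_less ab km by blast
    have sem_c: "sem ?c \<tau> = (if k < g \<and> g \<le> q then put RR i (Suc q) (put qv 0 q \<tau>) else put qv 0 q \<tau>)"
      using regs offs kv by (simp add: q_def g_def)
    show "?I (Suc k) (put kv 0 (Suc k) (sem ?c \<tau>))"
    proof (cases "k < g \<and> g \<le> q")
      case True
      \<comment> \<open>Candidate number \<open>k\<close> is among the top \<open>?R\<close> of both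
        voters, so \<open>q < ?R\<close> and raising the entry to \<open>Suc q\<close> does not
        overshoot.\<close>
      then have "P a ! k \<in> set (take ?R (P a))"
        using I P_in_take_iff[OF ab(3) km] by (simp add: g_def)
      then have "q < ?R" using q R(3) by simp
      moreover have "P a ! k' \<in> set (take (Suc q) (P b))" if "k' < Suc k" for k'
      proof (cases "k' = k")
        case False
        then have "P a ! k' \<in> set (take g (P b))" using that True I by (simp add: g_def)
        then show ?thesis using True set_take_subset_set_take[of g "Suc q" "P b"] by auto
      qed (use q[of "Suc q"] in simp)
      ultimately show ?thesis using True I unfolding sem_c by simp
    next
      case False
      then have "P a ! k \<in> set (take g (P b))" if "k < g" using that q[of g] by auto
      then show ?thesis using False I unfolding sem_c g_def by (auto simp: less_Suc_eq)
    qed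
  qed auto
  define \<rho> where "\<rho> = sem rank_prog \<sigma>"
  have \<rho>: "\<rho> = sem (PFor kv 1 ?c) ?s"
    unfolding \<rho>_def rank_prog_def using ab by (simp add: i_def)
  define g where "g = \<rho> RR i"
  have g: "1 \<le> g" "g \<le> ?R" "\<And>k. k < g \<Longrightarrow> P a ! k \<in> set (take g (P b))"
    using inv R(2) unfolding \<rho>[symmetric] g_def s0 by auto
  have "set (take g (P a)) \<subseteq> set (take g (P b))"
    using set_take_P[of a g] ab(3) g R(2) by auto
  then have "set (take g (P a)) = set (take g (P b))"
    using ab g R(2) perm_distinct[OF perm] perm_length[OF perm] by (intro set_take_eqI) auto
  then have "?R \<le> g" using g(1) common_rank_le[OF m perm perm, OF ab(3,4)] by blast
  then show "sem rank_prog \<sigma> RR i = common_rank (P a) (P b)"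
    using g(2) by (simp add: g_def \<rho>_def)
  show "x \<noteq> i \<Longrightarrow> sem rank_prog \<sigma> RR x = \<sigma> RR x"
    using inv unfolding \<rho>[symmetric] by (simp add: \<rho>_def)
qed

lemma sem_rank_table:
  assumes "tables s" "a < n" "b < n"
  shows "sem (for_pairs rank_prog) s RR (a * n + b) = common_rank (P a) (P b)"
proof -
  let ?I = "\<lambda>xs (\<sigma> :: store). \<forall>(a, b)\<in>set xs. \<sigma> RR (a * n + b) = common_rank (P a) (P b)"
  have s0: "s 0 0 = n" using assms A by (simp add: tables_def)
  have "?I (List.product [0..<s 0 0] [0..<s 0 0]) (sem (for_pairs rank_prog) s)"
  proof (rule sem_for_pairs[where I = ?I], unfold s0)
    fix xs a b \<sigma>
    assume ab: "a < n" "b < n" and xs: "set xs \<subseteq> {..<n} \<times> {..<n}" "(a, b) \<notin> set xs"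
      and fr: "\<And>x. x \<notin> {row, av, bv} \<union> writes rank_prog \<Longrightarrow> \<sigma> x = s x"
      and regs: "\<sigma> row 0 = a * n" "\<sigma> av 0 = a" "\<sigma> bv 0 = b" and I: "?I xs \<sigma>"
    have tab: "tables \<sigma>" using fr by (intro tables_cong[OF assms(1)]) (auto simp: rank_prog_def)
    have "sem rank_prog \<sigma> RR (a' * n + b') = \<sigma> RR (a' * n + b')" if "(a', b') \<in> set xs" for a' b'
    proof -
      have "b' < n" "(a', b') \<noteq> (a, b)" using that xs by auto
      then have "a' * n + b' \<noteq> a * n + b" using pair_index_eq[of b' n b a' a] ab by blast
      then show ?thesis using sem_rank(2)[OF tab regs(2,3) ab] regs by simp
    qed
    then show "?I (xs @ [(a, b)]) (sem rank_prog \<sigma>)"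
      using I sem_rank(1)[OF tab regs(2,3) ab] regs by fastforce
  qed (auto simp: rank_prog_def)
  then show ?thesis using s0 assms by auto
qed

lemma sem_subset:
  assumes \<sigma>: "tables \<sigma>" and regs: "\<sigma> av 0 = a" "a < n" "\<sigma> yav 0 = y" "y < n" "\<sigma> yrv 0 = yr" "yr \<le> m"
    and r: "\<sigma> RR (\<sigma> row 0 + \<sigma> bv 0) = r" "r \<le> m"
  shows "sem subset_prog \<sigma> okv 0 > 0 \<longleftrightarrow> set (take r (P a)) \<subset> set (take yr (P y))"
proof -
  let ?c = "PIf (Monus (Read RR cell) (var kv))
         (PIf (Monus (Plus (Read PT (Plus (Read OFF (var yav)) cand)) (Const 1)) (var yrv))
           (assign okv (Const 0)) skip) skip"
  let ?s = "put okv 0 (yr - r) \<sigma>"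
  let ?I = "\<lambda>k (\<tau> :: store). \<tau> okv 0 > 0 \<longleftrightarrow>
    r < yr \<and> (\<forall>k'<k. k' < r \<longrightarrow> P a ! k' \<in> set (take yr (P y)))"
  have s0: "?s 0 1 = m" using \<sigma> A by (simp add: tables_def)
  have "?I (?s 0 1) (sem (PFor kv 1 ?c) ?s)"
  proof (rule sem_For[where I = ?I])
    fix k \<tau>
    assume k: "k < ?s 0 1" and fr: "\<And>x. x \<notin> insert kv (writes ?c) \<Longrightarrow> \<tau> x = ?s x"
      and kv: "\<tau> kv 0 = k" and I: "?I k \<tau>"
    have km: "k < m" using k s0 by simp
    have \<tau>: "tables \<tau>" using fr by (intro tables_cong[OF \<sigma>]) auto
    have regs': "\<tau> av 0 = a" "\<tau> yav 0 = y" "\<tau> yrv 0 = yr" "\<tau> RR (\<tau> row 0 + \<tau> bv 0) = r"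
      using fr[of av] fr[of yav] fr[of yrv] fr[of RR] fr[of row] fr[of bv] regs r by auto
    have offs: "\<tau> OFF y = off y" "\<tau> 0 (\<tau> OFF a + k) = P a ! k"
      using \<tau> regs A_off[OF regs(2) km] by (auto simp: tables_def)
    define q where "q = \<tau> PT (off y + P a ! k)"
    have q: "q < yr \<longleftrightarrow> P a ! k \<in> set (take yr (P y))"
      unfolding q_def using tables_less_iff[OF \<tau> regs(4)] P_less regs km by blast
    have "sem ?c \<tau> = (if k < r \<and> yr \<le> q then put okv 0 0 \<tau> else \<tau>)"
      using regs' offs kv by (simp add: q_def)
    then show "?I (Suc k) (put kv 0 (Suc k) (sem ?c \<tau>))"
      using I q by (auto simp: less_Suc_eq)
  qed auto
  moreover have "sem subset_prog \<sigma> = sem (PFor kv 1 ?c) ?s"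
    unfolding subset_prog_def using regs r by simp
  ultimately have "sem subset_prog \<sigma> okv 0 > 0 \<longleftrightarrow>
      r < yr \<and> (\<forall>k'<m. k' < r \<longrightarrow> P a ! k' \<in> set (take yr (P y)))"
    using s0 by simp
  also have "\<dots> \<longleftrightarrow> r < yr \<and> set (take r (P a)) \<subseteq> set (take yr (P y))"
    using set_take_P[OF regs(2) r(2)] r(2) by auto
  also have "\<dots> \<longleftrightarrow> set (take r (P a)) \<subset> set (take yr (P y))"
    using card_set_take_P[OF regs(2) r(2)] card_set_take_P[OF regs(4,6)]
      psubset_card_mono[of "set (take yr (P y))" "set (take r (P a))"] by auto
  finally show ?thesis .
qed

section \<open>Selection, shrinking and counting\<close>

definition best :: "store \<Rightarrow> nat \<times> nat \<times> nat \<times> nat" where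
  "best s = (s bsv 0, s blv 0, s bav 0, s brv 0)"

lemma sem_improve:
  assumes \<sigma>: "tables \<sigma>" and ab: "\<sigma> av 0 = a" "a < n" "\<sigma> bv 0 = b" "b < n"
    and y: "\<sigma> yav 0 = ya" "ya < n" "\<sigma> yrv 0 = yr" "yr \<le> m"
    and r: "\<sigma> RR (\<sigma> row 0 + b) = common_rank (P a) (P b)"
    and cnt: "\<sigma> CNT (\<sigma> row 0 + b) = \<gamma> a b"
    and bl: "\<sigma> blv 0 \<le> n"
  shows "best (sem improve_prog \<sigma>) = improve P \<gamma> (ya, yr) (a, b) (best \<sigma>)"
    and "sem improve_prog \<sigma> blv 0 \<le> n"
proof -
  define \<sigma>1 where "\<sigma>1 = sem subset_prog \<sigma>"
  define \<sigma>2 where "\<sigma>2 = sem (mult_prog p1v (Plus (Read CNT cell) (Const 1)) (var blv)) \<sigma>1"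
  define \<sigma>3 where "\<sigma>3 = sem (mult_prog p2v (var bsv) (Monus (Plus (var bv) (Const 1)) (var av))) \<sigma>2"
  have R: "common_rank (P a) (P b) \<le> m"
    using common_rank_props(2)[OF m perm perm, OF ab(2,4)] .
  have fr1: "\<sigma>1 x = \<sigma> x" if "x \<notin> {25, kv, okv}" for x
    unfolding \<sigma>1_def using that by (intro sem_frame) (simp add: subset_prog_def)
  have fr2: "\<sigma>2 x = \<sigma>1 x" if "x \<notin> {25, iv, p1v}" for x
    unfolding \<sigma>2_def using that by (intro sem_frame) (simp add: mult_prog_def)
  have fr3: "\<sigma>3 x = \<sigma>2 x" if "x \<notin> {25, iv, p2v}" for x
    unfolding \<sigma>3_def using that by (intro sem_frame) (simp add: mult_prog_def)
  have s0: "\<sigma>1 0 0 = n" "\<sigma>2 0 0 = n"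
    using fr1[of 0] fr2[of 0] \<sigma> A by (auto simp: tables_def)
  have ok: "\<sigma>1 okv 0 > 0 \<longleftrightarrow> common_top P a b \<subset> set (take yr (P ya))"
    unfolding \<sigma>1_def common_top_def using ab r by (intro sem_subset[OF \<sigma> ab(1,2) y _ R]) simp
  have p1: "\<sigma>2 p1v 0 = Suc (\<gamma> a b) * \<sigma> blv 0"
    unfolding \<sigma>2_def
    by (subst sem_mult) (use ab cnt bl s0 fr1[of CNT] fr1[of row] fr1[of bv] fr1[of blv] in auto)
  have p2: "\<sigma>3 p2v 0 = \<sigma> bsv 0 * (Suc b - a)"
    unfolding \<sigma>3_def
    by (subst sem_mult) (use ab s0 fr2[of bsv] fr2[of bv] fr2[of av] fr1[of bsv] fr1[of bv] fr1[of av] in auto)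
  have "\<sigma>3 okv 0 = \<sigma>1 okv 0" "\<sigma>3 p1v 0 = \<sigma>2 p1v 0"
    using fr3[of okv] fr2[of okv] fr3[of p1v] by auto
  note ok3 = ok[folded this(1)] and p13 = p1[folded this(2)]
  have keep: "\<sigma>3 x = \<sigma> x" if "x \<notin> {25, kv, okv, iv, p1v, p2v}" for x
    using that fr1[of x] fr2[of x] fr3[of x] by simp
  have regs: "\<sigma>3 av 0 = a" "\<sigma>3 bv 0 = b" "\<sigma>3 RR (\<sigma>3 row 0 + b) = common_rank (P a) (P b)"
    "\<sigma>3 CNT (\<sigma>3 row 0 + b) = \<gamma> a b" "\<sigma>3 bsv = \<sigma> bsv" "\<sigma>3 blv = \<sigma> blv" "\<sigma>3 bav = \<sigma> bav" "\<sigma>3 brv = \<sigma> brv"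
    using keep ab r cnt by simp_all
  \<comment> \<open>This keeps the recorded length at most \<open>n\<close>, as the next
    multiplication by it requires.\<close>
  have "Suc b - a \<le> n" using ab by simp
  have "sem improve_prog \<sigma> = (if \<sigma>3 okv 0 > 0 \<and> \<sigma>3 p1v 0 < \<sigma>3 p2v 0
      then put brv 0 (common_rank (P a) (P b)) (put bav 0 a (put blv 0 (Suc b - a) (put bsv 0 (Suc (\<gamma> a b)) \<sigma>3)))
      else \<sigma>3)"
    unfolding improve_prog_def sem.simps(2) \<sigma>1_def[symmetric] \<sigma>2_def[symmetric] \<sigma>3_def[symmetric]
    using regs by simp
  then show "best (sem improve_prog \<sigma>) = improve P \<gamma> (ya, yr) (a, b) (best \<sigma>)"
    and "sem improve_prog \<sigma> blv 0 \<le> n"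
    using regs(5-) bl \<open>Suc b - a \<le> n\<close> unfolding ok3 p13 p2 by (simp_all add: best_def improve_def)
qed

lemma sem_shrink:
  assumes s: "tables s"
    and r: "\<And>a b. a < n \<Longrightarrow> b < n \<Longrightarrow> s RR (a * n + b) = common_rank (P a) (P b)"
    and cnt: "\<And>a b. a < n \<Longrightarrow> b < n \<Longrightarrow> s CNT (a * n + b) = \<gamma> a b"
    and y: "s yav 0 < n" "s yrv 0 \<le> m"
  shows "(sem shrink_prog s yav 0, sem shrink_prog s yrv 0) = shrink n P \<gamma> (s yav 0, s yrv 0)"
proof -
  let ?s = "put brv 0 0 (put bav 0 0 (put blv 0 0 (put bsv 0 1 s)))"
  let ?y = "(s yav 0, s yrv 0)"
  let ?I = "\<lambda>xs (\<sigma> :: store). best \<sigma> = fold (improve P \<gamma> ?y) xs (1, 0, 0, 0) \<and> \<sigma> blv 0 \<le> n"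
  define \<tau> where "\<tau> = sem (for_pairs improve_prog) ?s"
  have w: "writes improve_prog = {25, kv, okv, iv, p1v, p2v, bsv, blv, bav, brv}"
    by (auto simp: improve_prog_def subset_prog_def mult_prog_def)
  have s0: "?s 0 0 = n" using s A by (simp add: tables_def)
  have "?I (List.product [0..<?s 0 0] [0..<?s 0 0]) \<tau>"
    unfolding \<tau>_def
  proof (rule sem_for_pairs[where I = ?I], unfold s0)
    fix xs a b \<sigma>
    assume ab: "a < n" "b < n"
      and fr: "\<And>x. x \<notin> {row, av, bv} \<union> writes improve_prog \<Longrightarrow> \<sigma> x = ?s x"
      and regs: "\<sigma> row 0 = a * n" "\<sigma> av 0 = a" "\<sigma> bv 0 = b" and I: "?I xs \<sigma>"
    have tab: "tables \<sigma>" using fr by (intro tables_cong[OF s]) (auto simp: w)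
    have *: "\<sigma> yav 0 = s yav 0" "\<sigma> yrv 0 = s yrv 0" "\<sigma> RR (\<sigma> row 0 + b) = common_rank (P a) (P b)"
        "\<sigma> CNT (\<sigma> row 0 + b) = \<gamma> a b"
      using fr[of yav] fr[of yrv] fr[of RR] fr[of CNT] regs r[OF ab] cnt[OF ab] by (auto simp: w)
    show "?I (xs @ [(a, b)]) (sem improve_prog \<sigma>)"
      using sem_improve[where \<gamma> = \<gamma>, OF tab regs(2) ab(1) regs(3) ab(2) *(1) y(1) *(2) y(2) *(3,4)] I by simp
  qed (auto simp: w best_def)
  then have \<tau>: "best \<tau> = fold (improve P \<gamma> ?y) (List.product [0..<n] [0..<n]) (1, 0, 0, 0)"
    using s0 by simp
  have "\<tau> yav = s yav" "\<tau> yrv = s yrv"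
    unfolding \<tau>_def by (simp_all add: sem_frame for_pairs_def w)
  moreover have "sem shrink_prog s =
      (if \<tau> blv 0 > 0 then put yrv 0 (\<tau> brv 0) (put yav 0 (\<tau> bav 0) \<tau>) else \<tau>)"
    unfolding shrink_prog_def sem.simps(2) sem_assign val.simps \<tau>_def[symmetric] by simp
  ultimately show ?thesis
    unfolding shrink_def \<tau>[symmetric] by (simp add: best_def)
qed

lemma sem_winner:
  assumes s: "tables s"
    and r: "\<And>a b. a < n \<Longrightarrow> b < n \<Longrightarrow> s RR (a * n + b) = common_rank (P a) (P b)"
    and cnt: "\<And>a b. a < n \<Longrightarrow> b < n \<Longrightarrow> s CNT (a * n + b) = \<gamma> a b"
  shows "sem winner_prog s wv 0 = winner n m P \<gamma>"
proof -
  let ?s = "put yrv 0 m (put yav 0 0 s)"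
  let ?I = "\<lambda>j (\<sigma> :: store). (\<sigma> yav 0, \<sigma> yrv 0) = (shrink n P \<gamma> ^^ j) (0, m)"
  define \<tau> where "\<tau> = sem (PFor itv 1 shrink_prog) ?s"
  have s0: "?s 0 1 = m" using s A by (simp add: tables_def)
  note adm = admissible_iterate[where n = n and m = m and P = P and \<gamma> = \<gamma>, OF n m perm]
  have "?I (?s 0 1) \<tau>"
    unfolding \<tau>_def
  proof (rule sem_For[where I = ?I])
    fix j \<sigma>
    assume fr: "\<And>x. x \<notin> insert itv (writes shrink_prog) \<Longrightarrow> \<sigma> x = ?s x" and I: "?I j \<sigma>"
    have tab: "tables \<sigma>" using fr by (intro tables_cong[OF s]) (auto simp: writes_shrink_prog)
    have y: "\<sigma> yav 0 < n" "\<sigma> yrv 0 \<le> m"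
      using adm[of j] I unfolding I[symmetric] by (auto simp: admissible_def)
    have "\<sigma> RR = s RR" "\<sigma> CNT = s CNT"
      using fr[of RR] fr[of CNT] by (auto simp: writes_shrink_prog)
    then have "(sem shrink_prog \<sigma> yav 0, sem shrink_prog \<sigma> yrv 0) = shrink n P \<gamma> (\<sigma> yav 0, \<sigma> yrv 0)"
      using r cnt by (intro sem_shrink[OF tab _ _ y]) auto
    then show "?I (Suc j) (put itv 0 (Suc j) (sem shrink_prog \<sigma>))"
      using I by simp
  qed (auto simp: writes_shrink_prog)
  then have \<tau>: "\<tau> yav 0 = fst ((shrink n P \<gamma> ^^ m) (0, m))"
    unfolding s0 by (metis fst_conv)
  have y: "\<tau> yav 0 < n"
    using adm[of m] unfolding \<tau> by (auto simp: admissible_def split: prod.splits)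
  have "tables \<tau>"
    unfolding \<tau>_def by (rule tables_cong[OF s]) (simp_all add: sem_frame writes_shrink_prog)
  then have "\<tau> 0 (\<tau> OFF (\<tau> yav 0)) = P (\<tau> yav 0) ! 0"
    using y A_off[OF y, of 0] m by (simp add: tables_def)
  moreover have "sem winner_prog s wv 0 = \<tau> 0 (\<tau> OFF (\<tau> yav 0))"
    using s0 by (simp add: winner_prog_def \<tau>_def)
  ultimately show ?thesis by (simp add: winner_def \<tau>)
qed

lemma sem_update:
  assumes s: "tables s"
    and r: "\<And>a b. a < n \<Longrightarrow> b < n \<Longrightarrow> s RR (a * n + b) = common_rank (P a) (P b)"
    and w: "s wv 0 < m" and ab: "a < n" "b < n"
  shows "sem update_prog s CNT (a * n + b) = s CNT (a * n + b) + of_bool (s wv 0 \<in> common_top P a b)"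
proof -
  let ?c = "PIf (Monus (Read RR cell) (Read PT (Plus (Read OFF (var av)) (var wv))))
     (PWrite CNT cell (Plus (Read CNT cell) (Const 1))) skip"
  \<comment> \<open>The invariant covers unvisited pairs as well: their entries must still hold the
    old counts when their turn comes.\<close>
  let ?I = "\<lambda>xs (\<sigma> :: store). \<forall>a<n. \<forall>b<n. \<sigma> CNT (a * n + b) =
    s CNT (a * n + b) + (if (a, b) \<in> set xs then of_bool (s wv 0 \<in> common_top P a b) else 0)"
  have s0: "s 0 0 = n" using s A by (simp add: tables_def)
  have "?I (List.product [0..<s 0 0] [0..<s 0 0]) (sem (for_pairs ?c) s)"
  proof (rule sem_for_pairs[where I = ?I], unfold s0)
    fix xs a b \<sigma>
    assume ab: "a < n" "b < n" and xs: "(a, b) \<notin> set xs"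
      and fr: "\<And>x. x \<notin> {row, av, bv} \<union> writes ?c \<Longrightarrow> \<sigma> x = s x"
      and regs: "\<sigma> row 0 = a * n" "\<sigma> av 0 = a" "\<sigma> bv 0 = b" and I: "?I xs \<sigma>"
    have tab: "tables \<sigma>" using fr by (intro tables_cong[OF s]) auto
    have eqs: "\<sigma> RR (\<sigma> row 0 + \<sigma> bv 0) = common_rank (P a) (P b)" "\<sigma> OFF a = off a" "\<sigma> wv 0 = s wv 0"
      using fr[of RR] fr[of wv] tab regs r[OF ab] ab by (auto simp: tables_def)
    have "sem ?c \<sigma> = (if s wv 0 \<in> common_top P a b
        then put CNT (a * n + b) (Suc (\<sigma> CNT (a * n + b))) \<sigma> else \<sigma>)"
      using eqs regs tables_less_iff[OF tab ab(1) w, of "common_rank (P a) (P b)"]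
      by (auto simp: common_top_def)
    then show "?I (xs @ [(a, b)]) (sem ?c \<sigma>)"
      using I xs ab pair_index_eq[of _ n b _ a] by auto
  qed auto
  then show ?thesis using ab s0 by (simp add: update_prog_def)
qed

end

section \<open>Correctness of the program\<close>

lemma length_concat_uniform:
  "\<forall>xs\<in>set xss. length xs = m \<Longrightarrow> length (concat xss) = length xss * m"
  by (induction xss) auto

lemma nth_concat_uniform:
  "\<forall>xs\<in>set xss. length xs = m \<Longrightarrow> i < length xss \<Longrightarrow> k < m \<Longrightarrow>
    concat xss ! (i * m + k) = xss ! i ! k"
proof (induction xss arbitrary: i)
  case (Cons xs xss)
  then show ?case by (cases i) (auto simp: nth_append)
qed simp

lemma index_less:
  fixes i k l m :: nat
  assumes "i < l" "k < m"
  shows "i * m + k < l * m"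
proof -
  have "i * m + k < Suc i * m" using assms(2) by simp
  also have "\<dots> \<le> l * m" using assms(1) by (intro mult_right_mono) auto
  finally show ?thesis .
qed

text \<open>After three sizes and the voter order come blocks of uniform length, so addresses are
  mixed-radix expansions. Each size is bounded by the input length because all sizes are
  positive.\<close>

lemma encode_facts:
  assumes "valid_election E"
  defines "n \<equiv> num_voters E" and "m \<equiv> num_cands E" and "A \<equiv> input_store (encode E) 0"
  shows "A 0 = n" "A 1 = m" "A 2 = horizon E"
    and "a < n \<Longrightarrow> A (3 + a) = voter_order E ! a"
    and "j < horizon E \<Longrightarrow> v < n \<Longrightarrow> k < m \<Longrightarrow>
      A (3 + n + ((j * n + v) * m + k)) = rankings E ! j ! v ! k"
    and "n \<le> length (encode E)" "m \<le> length (encode E)" "horizon E \<le> length (encode E)"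
proof -
  let ?\<sigma> = "voter_order E" and ?R = "rankings E"
  have order: "length ?\<sigma> = n"
    using assms(1) unfolding valid_election_def n_def by (auto simp: perm_length)
  have R: "\<forall>P\<in>set ?R. length P = n" "\<forall>\<rho>\<in>set (concat ?R). length \<rho> = m"
    using assms(1) unfolding valid_election_def n_def m_def by (auto simp: perm_length)
  have len1: "length (concat ?R) = horizon E * n"
    using length_concat_uniform[OF R(1)] by (simp add: horizon_def)
  have len2: "length (concat (concat ?R)) = horizon E * n * m"
    using length_concat_uniform[OF R(2)] len1 by simp
  have enc: "encode E = n # m # horizon E # ?\<sigma> @ concat (concat ?R)"
    by (simp add: encode_def n_def m_def)
  have len: "length (encode E) = 3 + n + horizon E * n * m"
    using order len2 by (simp add: enc)
  have A: "A i = (if i < length (encode E) then encode E ! i else 0)" for i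
    by (simp add: A_def input_store_def)
  show "A 0 = n" "A 1 = m" "A 2 = horizon E"
    unfolding A len by (simp_all add: enc)
  show "A (3 + a) = ?\<sigma> ! a" if "a < n"
    unfolding A len using that order by (simp add: enc nth_append eval_nat_numeral)
  show "A (3 + n + ((j * n + v) * m + k)) = ?R ! j ! v ! k" if "j < horizon E" "v < n" "k < m"
  proof -
    have 1: "j * n + v < length (concat ?R)" using index_less[OF that(1,2)] len1 by simp
    have 2: "(j * n + v) * m + k < length (concat (concat ?R))"
      using index_less[OF 1 that(3)] len1 len2 by simp
    then have "A (3 + n + ((j * n + v) * m + k)) = concat (concat ?R) ! ((j * n + v) * m + k)"
      unfolding A len using len2 order by (simp add: enc nth_append eval_nat_numeral)
    also have "\<dots> = concat ?R ! (j * n + v) ! k" by (rule nth_concat_uniform[OF R(2) 1 that(3)])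
    also have "concat ?R ! (j * n + v) = ?R ! j ! v"
      using nth_concat_uniform[OF R(1)] that by (simp add: horizon_def)
    finally show ?thesis .
  qed
  have pos: "n \<ge> 1" "m \<ge> 1" "horizon E \<ge> 1"
    using assms(1) by (auto simp: valid_election_def n_def m_def)
  then have "1 * m \<le> (horizon E * n) * m" "horizon E * 1 \<le> horizon E * (n * m)"
    using mult_le_mono[of 1 "horizon E" 1 n] mult_le_mono[of 1 n 1 m]
    by (intro mult_right_mono mult_left_mono; simp)+
  then show "n \<le> length (encode E)" "m \<le> length (encode E)" "horizon E \<le> length (encode E)"
    unfolding len by (simp_all only: mult.assoc mult_1 mult_1_right)
qed

section \<open>Simulation of all rounds\<close>

lemma sem_offsets:
  assumes "a < s 0 0"
  shows "sem offsets_prog s OFF a = s base 0 + s 0 1 * s 0 (3 + a)"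
proof -
  let ?c = "PWrite OFF (var av) (Plus (Read OFF (var av)) (inp (Plus (Const 3) (var av))))"
  let ?d = "PWrite OFF (var av) (var base) ;; PFor iv 1 ?c"
  let ?I = "\<lambda>a (\<sigma> :: store). \<forall>a'<a. \<sigma> OFF a' = s base 0 + s 0 1 * s 0 (3 + a')"
  have "?I (s 0 0) (sem (PFor av 0 ?d) s)"
  proof (rule sem_For[where I = ?I])
    fix a \<sigma>
    assume fr: "\<And>x. x \<notin> insert av (writes ?d) \<Longrightarrow> \<sigma> x = s x" and av: "\<sigma> av 0 = a" and I: "?I a \<sigma>"
    let ?s = "put OFF a (\<sigma> base 0) \<sigma>"
    let ?K = "\<lambda>k (\<tau> :: store). ?I a \<tau> \<and> \<tau> OFF a = s base 0 + k * s 0 (3 + a)"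
    have \<sigma>: "\<sigma> 0 = s 0" "\<sigma> base = s base" using fr[of 0] fr[of base] by auto
    have "?K (?s 0 1) (sem (PFor iv 1 ?c) ?s)"
    proof (rule sem_For[where I = ?K])
      fix k \<tau>
      assume fr': "\<And>x. x \<notin> insert iv (writes ?c) \<Longrightarrow> \<tau> x = ?s x" and K: "?K k \<tau>"
      have "\<tau> 0 = s 0" "\<tau> av 0 = a" using fr'[of 0] fr'[of av] \<sigma> av by auto
      then show "?K (Suc k) (put iv 0 (Suc k) (sem ?c \<tau>))" using K by simp
    qed (use I \<sigma> in auto)
    then show "?I (Suc a) (put av 0 (Suc a) (sem ?d \<sigma>))"
      using \<sigma> av by (simp add: less_Suc_eq)
  qed auto
  then show ?thesis using assms by (simp add: offsets_prog_def)
qed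

lemma sem_advance:
  "sem (PFor av 0 (assign base (Plus (var base) (inp (Const 1))))) s base 0 = s base 0 + s 0 0 * s 0 1"
proof (rule sem_For[where I = "\<lambda>k \<sigma>. \<sigma> base 0 = s base 0 + k * s 0 1"])
  let ?c = "assign base (Plus (var base) (inp (Const 1)))"
  fix k \<sigma>
  assume fr: "\<And>x. x \<notin> insert av (writes ?c) \<Longrightarrow> \<sigma> x = s x" and I: "\<sigma> base 0 = s base 0 + k * s 0 1"
  then show "put av 0 (Suc k) (sem ?c \<sigma>) base 0 = s base 0 + Suc k * s 0 1"
    using fr[of 0] by simp
qed auto

lemma writes_progs:
  "writes offsets_prog = {OFF, iv, av}"
  "writes positions_prog = {PT, kv, av}"
  "writes (for_pairs rank_prog) = {row, av, bv, RR, kv, qv, 25}"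
  "writes winner_prog = insert itv (insert wv (writes shrink_prog))"
  "writes update_prog = {row, av, bv, CNT, 25}"
  by (auto simp: offsets_prog_def positions_prog_def for_pairs_def rank_prog_def winner_prog_def
    update_prog_def writes_shrink_prog)

lemma sem_round:
  assumes valid: "valid_election E" and j: "j < horizon E"
  defines "n \<equiv> num_voters E" and "m \<equiv> num_cands E" and "Q \<equiv> profile E"
    and "A \<equiv> input_store (encode E) 0"
  assumes s: "s 0 = A" "s jv 0 = j" "s base 0 = 3 + n + j * (n * m)"
    and cnt: "\<And>a b. a < n \<Longrightarrow> b < n \<Longrightarrow> s CNT (a * n + b) = counts n m Q j a b"
  defines "w \<equiv> winner n m (Q j) (counts n m Q j)"
  shows "sem round_prog s base 0 = 3 + n + Suc j * (n * m)"
    and "a < n \<Longrightarrow> b < n \<Longrightarrow> sem round_prog s CNT (a * n + b) = counts n m Q (Suc j) a b"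
    and "sem round_prog s 1 = (s 1)(j := w)"
proof -
  let ?v = "\<lambda>a. voter_order E ! a"
  define off where "off a = 3 + n + j * (n * m) + m * ?v a" for a
  note enc = encode_facts[OF valid, folded n_def m_def A_def]
  have n: "n > 0" and m: "m \<ge> 1"
    using valid by (auto simp: valid_election_def n_def m_def)
  have order: "voter_order E \<in> permutations_of_set {..<n}"
    using valid by (simp add: valid_election_def n_def)
  \<comment> \<open>Blocks of different positions are disjoint because mixed-radix expansions are
    unique and the voter order has no repetition.\<close>
  interpret single_round A n m off "Q j"
  proof
    show "Q j a \<in> permutations_of_set {..<m}" if "a < n" for a
      using profile_perm[OF valid j] that by (simp add: n_def m_def Q_def)
    show "A (off a + k) = Q j a ! k" if "a < n" "k < m" for a k
    proof -
      have "off a + k = 3 + n + ((j * n + ?v a) * m + k)"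
        by (simp add: off_def algebra_simps)
      then show ?thesis
        using enc(5)[OF j perm_nth_less[OF order that(1)] that(2)] unfolding Q_def profile_def by (simp only:)
    qed
    show "a = b" if "a < n" "b < n" "c < m" "d < m" "off a + c = off b + d" for a b c d
    proof -
      have "?v a * m + c = ?v b * m + d" using that(5) by (simp add: off_def algebra_simps)
      then have "?v a = ?v b" using pair_index_eq that(3,4) by blast
      then show ?thesis
        using that(1,2) order by (simp add: nth_eq_iff_index_eq perm_distinct perm_length)
    qed
  qed (use enc n m in simp_all)
  define s1 where "s1 = sem offsets_prog s"
  define s2 where "s2 = sem positions_prog s1"
  define s3 where "s3 = sem (for_pairs rank_prog) s2"
  define s4 where "s4 = sem winner_prog s3"
  define s5 where "s5 = put 1 j (s4 wv 0) s4"
  define s6 where "s6 = sem update_prog s5"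
  let ?adv = "PFor av 0 (assign base (Plus (var base) (inp (Const 1))))"
  define s7 where "s7 = sem ?adv s6"
  note frames = sem_frame[of _ offsets_prog s, folded s1_def, unfolded writes_progs]
    sem_frame[of _ positions_prog s1, folded s2_def, unfolded writes_progs]
    sem_frame[of _ "for_pairs rank_prog" s2, folded s3_def, unfolded writes_progs]
    sem_frame[of _ winner_prog s3, folded s4_def, unfolded writes_progs writes_shrink_prog]
    sem_frame[of _ update_prog s5, folded s6_def, unfolded writes_progs]
    sem_frame[of _ ?adv s6, folded s7_def, unfolded writes.simps writes_simps]
  have input: "s1 0 = A" "s2 0 = A" "s3 0 = A" "s4 0 = A" "s5 0 = A" "s6 0 = A"
    using s(1) by (simp_all add: frames s5_def)
  have "s1 OFF a = off a" if "a < n" for a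
    unfolding s1_def using that s enc by (subst sem_offsets) (simp_all add: off_def)
  then have "tables s2" unfolding s2_def using input(1) by (intro sem_positions)
  then have rr: "s3 RR (a * n + b) = common_rank (Q j a) (Q j b)" if "a < n" "b < n" for a b
    unfolding s3_def using that by (intro sem_rank_table)
  have t3: "tables s3" by (rule tables_cong[OF \<open>tables s2\<close>]) (simp_all add: frames)
  have w4: "s4 wv 0 = w"
    unfolding s4_def w_def by (rule sem_winner[OF t3 rr]) (simp_all add: frames cnt)
  have t5: "tables s5" by (rule tables_cong[OF t3]) (simp_all add: frames s5_def)
  have "s5 wv 0 = w" using w4 by (simp add: s5_def)
  have w: "w < m"
    unfolding w_def by (rule winner_less[OF n m]) (use profile_perm[OF valid j] in \<open>simp add: Q_def n_def m_def\<close>)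
  have upd: "s6 CNT (a * n + b) = counts n m Q j a b + of_bool (w \<in> common_top (Q j) a b)"
    if "a < n" "b < n" for a b
    unfolding s6_def using that t5 w \<open>s5 wv 0 = w\<close> rr
    by (subst sem_update) (simp_all add: s5_def frames cnt)
  have "s4 jv 0 = j" using s(2) by (simp add: frames)
  then have s7: "sem round_prog s = s7"
    unfolding round_prog_def sem.simps(1,2) s1_def[symmetric] s2_def[symmetric] s3_def[symmetric]
      s4_def[symmetric] by (simp add: s5_def s6_def s7_def)
  show "sem round_prog s base 0 = 3 + n + Suc j * (n * m)"
    unfolding s7 s7_def sem_advance using s(3) input(6) enc(1,2) by (simp add: frames s5_def)
  show "a < n \<Longrightarrow> b < n \<Longrightarrow> sem round_prog s CNT (a * n + b) = counts n m Q (Suc j) a b"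
    unfolding s7 using upd by (simp add: frames w_def)
  show "sem round_prog s 1 = (s 1)(j := w)"
    unfolding s7 using w4 by (simp add: frames s5_def)
qed

text \<open>Between rounds only the base address, the table of counts and the winners written so far
  matter; all other tables are rebuilt in every round.\<close>

lemma sem_main:
  assumes valid: "valid_election E"
  shows "map (sem main_prog (input_store (encode E)) 1) [0..<horizon E] = edf_rule E"
proof -
  define n m Q A where "n = num_voters E" and "m = num_cands E" and "Q = profile E"
    and "A = input_store (encode E) 0"
  note enc = encode_facts[OF valid, folded n_def m_def A_def]
  let ?s = "put base 0 (3 + n) (input_store (encode E))"
  let ?I = "\<lambda>j (\<sigma> :: store). \<sigma> base 0 = 3 + n + j * (n * m) \<and>
    (\<forall>a<n. \<forall>b<n. \<sigma> CNT (a * n + b) = counts n m Q j a b) \<and>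
    (\<forall>i<j. \<sigma> 1 i = winner n m (Q i) (counts n m Q i))"
  have s0: "?s 0 = A" by (simp add: A_def)
  have wr: "0 \<notin> writes round_prog" "jv \<notin> writes round_prog"
    by (simp_all add: round_prog_def writes_progs writes_shrink_prog)
  have "?I (?s 0 2) (sem (PFor jv 2 round_prog) ?s)"
  proof (rule sem_For[where I = ?I])
    show "jv \<notin> writes round_prog" using wr by auto
    show "?I 0 (put jv 0 0 ?s)" by (simp add: input_store_def)
    fix j \<sigma>
    assume j: "j < ?s 0 2" and fr: "\<And>x. x \<notin> insert jv (writes round_prog) \<Longrightarrow> \<sigma> x = ?s x"
      and jv: "\<sigma> jv 0 = j" and I: "?I j \<sigma>"
    have "0 \<notin> insert jv (writes round_prog)" using wr by auto
    then have in0: "\<sigma> 0 = input_store (encode E) 0" using fr[of 0] by simp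
    have "j < horizon E" using j s0 enc(3) by simp
    note round = sem_round[OF valid this in0 jv, folded n_def m_def Q_def]
    show "?I (Suc j) (put jv 0 (Suc j) (sem round_prog \<sigma>))"
      using round I by (simp add: less_Suc_eq)
  qed
  then have "\<forall>i<horizon E. sem (PFor jv 2 round_prog) ?s 1 i = winner n m (Q i) (counts n m Q i)"
    using s0 enc(3) by simp
  moreover have "sem main_prog (input_store (encode E)) = sem (PFor jv 2 round_prog) ?s"
    using enc(1) by (simp add: main_prog_def A_def)
  ultimately show ?thesis
    by (simp add: edf_rule_def n_def m_def Q_def)
qed

text \<open>The three size cells bound all loops, and each is at most the input length, at which the
  cost polynomial can therefore be evaluated.\<close>

lemma edf_rule_polynomial_time: "polynomial_time edf_rule"
  unfolding polynomial_time_def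
proof (intro exI[of _ "compile main_prog"] exI[of _ "cost main_prog"] allI impI)
  fix E assume valid: "valid_election E"
  let ?s = "input_store (encode E)"
  have "?s 0 k \<le> length (encode E)" if "k < 3" for k
  proof -
    have "k = 0 \<or> k = 1 \<or> k = 2" using that by auto
    then show ?thesis using encode_facts[OF valid] by auto
  qed
  then obtain t where "t \<le> poly (cost main_prog) (length (encode E))"
    "exec (compile main_prog) ?s t (sem main_prog ?s)"
    using exec_compile[OF well_formed_main] by blast
  then show "\<exists>t s. exec (compile main_prog) ?s t s \<and>
      t \<le> poly (cost main_prog) (length (encode E)) \<and> map (s 1) [0..<horizon E] = edf_rule E"
    using sem_main[OF valid] by blast
qed

theorem theorem5p7:
  "\<exists>f. rule f \<and> online f \<and> polynomial_time f \<and>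
     satisfies_on single_crossing rank_wPSC f \<and>
     satisfies_on single_crossing rank_wPSC_droop f"
  using edf_rule_rule edf_rule_online edf_rule_polynomial_time edf_rule_hare edf_rule_droop by blast

end
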